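(* There exists a universal constant $C>0$ such that the following holds. Let $1\le s\le d$ be integers, let $0<\varepsilon<1$ and $0<\eta<1/2$, and set $$a_s=Cs\log\left(\frac{ed}{s}\right)+\log\left(\frac{16}{\eta}\right).$$ Let $A,B\in O(d)$ and $I\subseteq\{1,\dots,d\}$ with $|I|=m$. Assume that $m\ge2025\,\varepsilon^{-2}a_s$ and $$144\,\kappa_I(A)\,\|B\|_\infty^2\,m\,a_s^2\le1.$$ Then, with probability at least $1-\eta$, the random linear map $\Phi=\sqrt{\frac dm}\,P_IAD_\xi P_\pi BD_{\xi'}:\mathbb R^d\to\mathbb R^m$ satisfies $$\delta_s(\Phi)\le\varepsilon.$$
   Context: $O(d)$ is the group of real orthogonal $d\times d$ matrices, $\mathbb S^{d-1}$ the Euclidean unit sphere of $\mathbb R^d$, $[d]=\{1,\dots,d\}$, $\|B\|_\infty=\max_{i,j}|B_{ij}|$. $P_I\in\mathbb R^{m\times d}$ is restriction to the coordinates in $I$. $\xi,\xi'$ are uniform on $\{-1,1\}^d$, $\pi$ is a uniform permutation in $S_d$, and $\xi,\xi',\pi$ are independent; $D_\xi=\operatorname{diag}(\xi_1,\dots,\xi_d)$, and $P_\pi$ is the permutation matrix with $(P_\pi x)_k=x_{\pi(k)}$. $\kappa_I(A)=\frac dm\max_{k\in[d]}\sum_{j\in I}A_{jk}^2$. The restricted isometry constant of order $s$ of a linear map $\Phi$ is $\delta_s(\Phi)=\sup\left\{\bigl|\|\Phi x\|_2^2-1\bigr|:x\in\mathbb S^{d-1},\ \|x\|_0\le s\right\}$,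 where $\|x\|_0=|\{j:x_j\ne0\}|$. *)

theory Defs
  imports "HOL-Probability.Probability" "Jordan_Normal_Form.DL_Submatrix"
begin

unbundle no vec_syntax
hide_const (open) Finite_Cartesian_Product.vec Finite_Cartesian_Product.mat
hide_type (open) Finite_Cartesian_Product.vec

text \<open>
  The dimension is quantified inside the theorem, after the universal constant, so vectors and
  matrices are the carrier-based ones, and coordinates are numbered \<open>0, \<dots>, d - 1\<close>.
\<close>

definition orthogonal_group :: "nat \<Rightarrow> real mat set" where
  "orthogonal_group d = {A \<in> carrier_mat d d. A\<^sup>T * A = 1\<^sub>m d \<and> A * A\<^sup>T = 1\<^sub>m d}"

definition vec_l2_norm :: "real vec \<Rightarrow> real" where
  "vec_l2_norm x = L2_set (\<lambda>i. x $ i) {..<dim_vec x}"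

definition vec_l0 :: "real vec \<Rightarrow> nat" where
  "vec_l0 x = card {j. j < dim_vec x \<and> x $ j \<noteq> 0}"

definition mat_max_norm :: "real mat \<Rightarrow> real" where
  "mat_max_norm B = (MAX (i, j) \<in> {..<dim_row B} \<times> {..<dim_col B}. \<bar>B $$ (i, j)\<bar>)"

definition kappa :: "nat set \<Rightarrow> real mat \<Rightarrow> real" where
  "kappa I A = real (dim_row A) / real (card I) * (MAX k\<in>{..<dim_row A}. \<Sum>j\<in>I. (A $$ (j, k))\<^sup>2)"

text \<open>The rows of the restriction matrix are ordered by increasing index in \<open>I\<close>.\<close>

definition restriction_mat :: "nat \<Rightarrow> nat set \<Rightarrow> real mat" where
  "restriction_mat d I = submatrix (1\<^sub>m d) I UNIV"

definition perm_mat :: "nat \<Rightarrow> (nat \<Rightarrow> nat) \<Rightarrow> real mat" where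
  "perm_mat d \<pi> = mat d d (\<lambda>(k, j). if j = \<pi> k then 1 else 0)"

definition rip_deviations :: "nat \<Rightarrow> real mat \<Rightarrow> real set" where
  "rip_deviations s \<Phi> =
     {\<bar>(vec_l2_norm (\<Phi> *\<^sub>v x))\<^sup>2 - 1\<bar> | x.
        x \<in> carrier_vec (dim_col \<Phi>) \<and> vec_l2_norm x = 1 \<and> vec_l0 x \<le> s}"

definition rip_const :: "nat \<Rightarrow> real mat \<Rightarrow> real" where
  "rip_const s \<Phi> = Sup (rip_deviations s \<Phi>)"

definition sign_vectors :: "nat \<Rightarrow> (nat \<Rightarrow> real) set" where
  "sign_vectors d = {..<d} \<rightarrow>\<^sub>E {- 1, 1}"

text \<open>Joint law of the independent triple \<open>(\<xi>, \<xi>', \<pi>)\<close>.\<close>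

definition randomness :: "nat \<Rightarrow> ((nat \<Rightarrow> real) \<times> (nat \<Rightarrow> real) \<times> (nat \<Rightarrow> nat)) pmf" where
  "randomness d =
     pair_pmf (pmf_of_set (sign_vectors d))
       (pair_pmf (pmf_of_set (sign_vectors d)) (pmf_of_set {\<pi>. \<pi> permutes {..<d}}))"

definition random_map ::
    "nat \<Rightarrow> nat set \<Rightarrow> real mat \<Rightarrow> real mat \<Rightarrow>
     (nat \<Rightarrow> real) \<Rightarrow> (nat \<Rightarrow> real) \<Rightarrow> (nat \<Rightarrow> nat) \<Rightarrow> real mat" where
  "random_map d I A B \<xi> \<xi>' \<pi> =
     sqrt (real d / real (card I)) \<cdot>\<^sub>m
       (restriction_mat d I * A * mat_diag d \<xi> * perm_mat d \<pi> * B * mat_diag d \<xi>')"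

definition sparsity_level :: "real \<Rightarrow> nat \<Rightarrow> nat \<Rightarrow> real \<Rightarrow> real" where
  "sparsity_level C d s \<eta> =
     C * real s * ln (exp 1 * real d / real s) + ln (16 / \<eta>)"

text \<open>
  Sanity checks: \<open>pmf_of_set\<close> is the uniform law only on finite nonempty sets, and \<open>Sup\<close> on
  the reals is the supremum only of nonempty bounded sets.
\<close>

lemma sign_vectors_finite_nonempty: "finite (sign_vectors d)" "sign_vectors d \<noteq> {}"
  by (auto simp: sign_vectors_def finite_PiE PiE_eq_empty_iff)

lemma permutations_finite_nonempty:
  "finite {\<pi>. \<pi> permutes {..<d::nat}}" "{\<pi>. \<pi> permutes {..<d::nat}} \<noteq> {}"
  by (simp add: finite_permutations) (use permutes_id in blast)

lemma restriction_mat_carrier: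
  assumes "I \<subseteq> {..<d}"
  shows "restriction_mat d I \<in> carrier_mat (card I) d"
proof -
  have "{i. i < d \<and> i \<in> I} = I" using assms by auto
  then show ?thesis
    by (intro carrier_matI) (simp_all only: restriction_mat_def dim_submatrix index_one_mat
        UNIV_I simp_thms card_Collect_less_nat)
qed

lemma restriction_mat_mult_vec:
  assumes "I \<subseteq> {..<d}" "x \<in> carrier_vec d" "k < card I"
  shows "(restriction_mat d I *\<^sub>v x) $ k = x $ (pick I k)"
proof -
  have I: "{i. i < d \<and> i \<in> I} = I" using assms by auto
  have p: "pick I k < d" using assms pick_in_set_le[of k I] by auto
  have "(restriction_mat d I *\<^sub>v x) $ k = (\<Sum>j<d. (if pick I k = j then 1 else 0) * x $ j)"
    using assms p
    by (auto simp: restriction_mat_def submatrix_def I scalar_prod_def pick_UNIV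
        atLeast0LessThan intro!: sum.cong)
  also have "\<dots> = (\<Sum>j<d. if pick I k = j then x $ j else 0)"
    by (intro sum.cong) auto
  also have "\<dots> = x $ (pick I k)" using p by simp
  finally show ?thesis .
qed

lemma perm_mat_mult_vec:
  assumes "\<pi> permutes {..<d}" "x \<in> carrier_vec d" "k < d"
  shows "(perm_mat d \<pi> *\<^sub>v x) $ k = x $ (\<pi> k)"
proof -
  have p: "\<pi> k < d" using assms permutes_in_image[of \<pi> "{..<d}" k] by auto
  have "(perm_mat d \<pi> *\<^sub>v x) $ k = (\<Sum>j<d. (if j = \<pi> k then 1 else 0) * x $ j)"
    using assms by (auto simp: perm_mat_def scalar_prod_def atLeast0LessThan intro!: sum.cong)
  also have "\<dots> = (\<Sum>j<d. if j = \<pi> k then x $ j else 0)"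
    by (intro sum.cong) auto
  also have "\<dots> = x $ (\<pi> k)" using p by simp
  finally show ?thesis .
qed

lemma rip_deviations_nonempty:
  assumes "1 \<le> s" "1 \<le> dim_col \<Phi>"
  shows "rip_deviations s \<Phi> \<noteq> {}"
proof -
  let ?d = "dim_col \<Phi>"
  let ?x = "unit_vec ?d 0 :: real vec"
  have "{j. j < dim_vec ?x \<and> ?x $ j \<noteq> 0} \<subseteq> {0}" by (auto split: if_splits)
  then have "vec_l0 ?x \<le> 1"
    unfolding vec_l0_def using card_mono[of "{0::nat}" "{j. j < dim_vec ?x \<and> ?x $ j \<noteq> 0}"] by simp
  moreover have "(\<Sum>i<?d. (?x $ i)\<^sup>2) = (\<Sum>i<?d. if i = 0 then 1 else 0)"
    by (intro sum.cong) auto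
  then have "vec_l2_norm ?x = 1"
    using assms by (simp add: vec_l2_norm_def L2_set_def)
  moreover have "?x \<in> carrier_vec ?d" by simp
  ultimately have "\<bar>(vec_l2_norm (\<Phi> *\<^sub>v ?x))\<^sup>2 - 1\<bar> \<in> rip_deviations s \<Phi>"
    unfolding rip_deviations_def using assms(1) by (blast intro: le_trans)
  then show ?thesis by blast
qed

lemma rip_deviations_bdd_above: "bdd_above (rip_deviations s \<Phi>)"
proof -
  let ?d = "dim_col \<Phi>" and ?m = "dim_row \<Phi>"
  let ?K = "\<Sum>i<?m. (\<Sum>j<?d. \<bar>\<Phi> $$ (i, j)\<bar>)\<^sup>2"
  have "\<bar>(vec_l2_norm (\<Phi> *\<^sub>v x))\<^sup>2 - 1\<bar> \<le> ?K + 1"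
    if x: "x \<in> carrier_vec ?d" "vec_l2_norm x = 1" for x
  proof -
    have *: "\<bar>x $ j\<bar> \<le> 1" if "j < ?d" for j
    proof -
      have "\<bar>x $ j\<bar> = sqrt ((x $ j)\<^sup>2)" by simp
      also have "\<dots> \<le> vec_l2_norm x"
        unfolding vec_l2_norm_def L2_set_def
        using that x by (intro real_sqrt_le_mono member_le_sum) auto
      finally show ?thesis using x by simp
    qed
    have "((\<Phi> *\<^sub>v x) $ i)\<^sup>2 \<le> (\<Sum>j<?d. \<bar>\<Phi> $$ (i, j)\<bar>)\<^sup>2" if i: "i < ?m" for i
    proof -
      have "(\<Phi> *\<^sub>v x) $ i = (\<Sum>j<?d. \<Phi> $$ (i, j) * x $ j)"
        using i x by (auto simp: scalar_prod_def atLeast0LessThan intro!: sum.cong)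
      also have "\<bar>\<dots>\<bar> \<le> (\<Sum>j<?d. \<bar>\<Phi> $$ (i, j) * x $ j\<bar>)" by (rule sum_abs)
      also have "\<dots> \<le> (\<Sum>j<?d. \<bar>\<Phi> $$ (i, j)\<bar>)"
        using * by (intro sum_mono) (auto simp: abs_mult mult_left_le)
      finally show ?thesis by (metis abs_ge_zero power2_abs power_mono)
    qed
    then have "(\<Sum>i<?m. ((\<Phi> *\<^sub>v x) $ i)\<^sup>2) \<le> ?K" by (intro sum_mono) auto
    moreover have "(vec_l2_norm (\<Phi> *\<^sub>v x))\<^sup>2 = (\<Sum>i<?m. ((\<Phi> *\<^sub>v x) $ i)\<^sup>2)"
      by (simp add: vec_l2_norm_def L2_set_def sum_nonneg)
    moreover have "0 \<le> (vec_l2_norm (\<Phi> *\<^sub>v x))\<^sup>2" by simp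
    ultimately show ?thesis by linarith
  qed
  then show ?thesis unfolding bdd_above_def rip_deviations_def by blast
qed

end

(*
  Write Phi x as the sum of xi_k z_k w_k, where z = P_pi B D_xi' x and w_k are the columns of
  sqrt(d/m) P_I A, so |w_k|^2 <= kappa_I(A). With probability 1 - 2 d e^(-a) over xi' all
  z_k^2 are at most 2 a |B|_oo^2, hence z_k^2 |w_k|^2 <= 1 / (72 m a).

  Diagonal: the sum of z_k^2 |w_k|^2 has mean 1 over pi, and it concentrates because, for
  u >= 0, the product of u(pi(k)) over k in K has expectation at most (mean of u)^|K|.

  Off-diagonal: let X_tau be |Phi x|^2 with the signs xi_k multiplied by independent signs tau_k. For
  fixed tau, X - X_tau = 4 <V_S, V_T>, where V_S and V_T sum over tau_k = 1 and over tau_k = -1.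
  Given the vector V with the smaller index set, resampling the signs and the permutation on the other
  set makes the inner product subgaussian with variance proxy about |V|^2 / m: at least half of the
  entries of z remain to be permuted, so the sum of z_k^2 <w_k, V>^2 is at most a constant times its
  average (1/d) (d/m) |V|^2. No matrix concentration inequality is needed. Averaging over tau, where
  X_tau averages to the diagonal, bounds X - 1 by a constant times sqrt(a/m) (1 + X).

  The factors d^2 lost in union bounds and in Markov's inequality, and the cardinality of a net of
  sparse grid vectors, are absorbed by C s log(e d / s) >= C (1 + log d).
*)
theory Submission
  imports Defs
begin

section \<open>Finite averages\<close>

text \<open>Two obstacles shape the proof. Values read along a random permutation are dependent; the
  product inequality lets their exponential moments be bounded as for sampling with replacement,
  also when only a subset of the positions is permuted. And the usual treatment of the off-diagonal
  part would need the operator norm of the sum of z_k^2 w_k w_k^T; once V is fixed, only the scalar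
  sum of z_k^2 <w_k, V>^2 is left to control. The price is a bound in terms of |V|, hence of X,
  which is what is to be bounded. Such a self-referential bound is closed twice: for X because its
  coefficient on the right is at most 1/15, and for \<open>rip_const\<close> because the net
  argument returns only half of it.

  Deviations are measured in r = sqrt(a/m), and exponential moments over \<xi> and \<pi> are taken
  at \<theta> = sqrt(m a), so that \<theta> r = a. The hypothesis with 144 says that \<theta>^2
  times the largest possible diagonal term is at most 1/72, so second-order terms of the exponential
  are harmless.\<close>

definition avg :: "'a set \<Rightarrow> ('a \<Rightarrow> real) \<Rightarrow> real" where
  "avg A f = (\<Sum>x\<in>A. f x) / real (card A)"

abbreviation freq :: "'a set \<Rightarrow> ('a \<Rightarrow> bool) \<Rightarrow> real" where
  "freq A P \<equiv> avg A (\<lambda>x. of_bool (P x))"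

lemma avg_mono: "(\<And>x. x \<in> A \<Longrightarrow> f x \<le> g x) \<Longrightarrow> avg A f \<le> avg A g"
  unfolding avg_def by (intro divide_right_mono sum_mono) auto

lemma avg_cong: "(\<And>x. x \<in> A \<Longrightarrow> f x = g x) \<Longrightarrow> avg A f = avg A g"
  unfolding avg_def by (simp cong: sum.cong)

lemma avg_nonneg: "(\<And>x. x \<in> A \<Longrightarrow> 0 \<le> f x) \<Longrightarrow> 0 \<le> avg A f"
  unfolding avg_def by (intro divide_nonneg_nonneg sum_nonneg) auto

lemma avg_const: "finite A \<Longrightarrow> A \<noteq> {} \<Longrightarrow> avg A (\<lambda>_. c) = c"
  unfolding avg_def by simp

lemma avg_add: "avg A (\<lambda>x. f x + g x) = avg A f + avg A g"
  unfolding avg_def by (simp add: sum.distrib add_divide_distrib)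

lemma avg_diff: "avg A (\<lambda>x. f x - g x) = avg A f - avg A g"
  unfolding avg_def by (simp add: sum_subtractf diff_divide_distrib)

lemma avg_mult_left: "avg A (\<lambda>x. c * f x) = c * avg A f"
  unfolding avg_def by (simp add: sum_distrib_left)

lemma avg_mult_right: "avg A (\<lambda>x. f x * c) = avg A f * c"
  unfolding avg_def by (simp add: sum_distrib_right)

lemma avg_divide: "avg A (\<lambda>x. f x / c) = avg A f / c"
  unfolding avg_def by (simp add: sum_divide_distrib[symmetric] mult.commute)

lemma avg_sum: "avg A (\<lambda>x. \<Sum>i\<in>I. f i x) = (\<Sum>i\<in>I. avg A (f i))"
  unfolding avg_def by (subst sum.swap) (simp add: sum_divide_distrib)

lemma avg_swap: "avg A (\<lambda>x. avg B (f x)) = avg B (\<lambda>y. avg A (\<lambda>x. f x y))"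
proof -
  have "avg A (\<lambda>x. avg B (f x)) = (\<Sum>x\<in>A. \<Sum>y\<in>B. f x y) / (real (card A) * real (card B))"
    unfolding avg_def by (simp add: sum_divide_distrib[symmetric] mult.commute)
  also have "\<dots> = (\<Sum>y\<in>B. \<Sum>x\<in>A. f x y) / (real (card A) * real (card B))"
    by (subst sum.swap) (rule refl)
  also have "\<dots> = avg B (\<lambda>y. avg A (\<lambda>x. f x y))"
    unfolding avg_def by (simp add: sum_divide_distrib[symmetric])
  finally show ?thesis .
qed

lemma avg_Times: "avg (A \<times> B) f = avg A (\<lambda>x. avg B (\<lambda>y. f (x, y)))"
  unfolding avg_def
  by (simp add: sum.cartesian_product card_cartesian_product
      sum_divide_distrib[symmetric] mult.commute)

lemma avg_reindex_bij:
  assumes "bij_betw h A A"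
  shows "avg A (\<lambda>x. f (h x)) = avg A f"
  unfolding avg_def using sum.reindex_bij_betw[OF assms, of f] by simp

lemma avg_le_const:
  assumes "finite A" "A \<noteq> {}" "\<And>x. x \<in> A \<Longrightarrow> f x \<le> c"
  shows "avg A f \<le> c"
  using avg_mono[of A f "\<lambda>_. c", OF assms(3)] avg_const[OF assms(1,2), of c] by simp

lemma abs_avg_le: "\<bar>avg A f\<bar> \<le> avg A (\<lambda>x. \<bar>f x\<bar>)"
  unfolding avg_def by (simp add: divide_right_mono)

lemma freq_mono: "(\<And>x. x \<in> A \<Longrightarrow> P x \<Longrightarrow> Q x) \<Longrightarrow> freq A P \<le> freq A Q"
  by (rule avg_mono) (auto simp: of_bool_def)

lemma freq_disj_le: "freq A (\<lambda>x. P x \<or> Q x) \<le> freq A P + freq A Q"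
  unfolding avg_add[symmetric] by (rule avg_mono) (auto simp: of_bool_def)

lemma freq_Bex_le:
  assumes "finite I"
  shows "freq A (\<lambda>x. \<exists>i\<in>I. P i x) \<le> (\<Sum>i\<in>I. freq A (P i))"
  unfolding avg_sum[symmetric]
proof (rule avg_mono)
  fix x
  show "of_bool (\<exists>i\<in>I. P i x) \<le> (\<Sum>i\<in>I. of_bool (P i x) :: real)"
  proof (cases "\<exists>i\<in>I. P i x")
    case True
    then obtain i where i: "i \<in> I" "P i x" by blast
    have "of_bool (P i x) \<le> (\<Sum>i\<in>I. of_bool (P i x) :: real)"
      using assms i by (intro member_le_sum) auto
    then show ?thesis using True i by simp
  qed (auto intro: sum_nonneg)
qed

lemma freq_markov:
  assumes "\<And>x. x \<in> A \<Longrightarrow> 0 \<le> f x" "0 < c"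
  shows "freq A (\<lambda>x. c \<le> f x) \<le> avg A f / c"
  unfolding avg_divide[symmetric]
  by (rule avg_mono) (use assms in \<open>auto simp: of_bool_def\<close>)

lemma freq_chernoff:
  shows "freq A (\<lambda>x. c \<le> f x) \<le> exp (- c) * avg A (\<lambda>x. exp (f x))"
proof -
  have "freq A (\<lambda>x. c \<le> f x) = freq A (\<lambda>x. exp c \<le> exp (f x))" by simp
  also have "\<dots> \<le> avg A (\<lambda>x. exp (f x)) / exp c" by (rule freq_markov) auto
  finally show ?thesis by (simp add: exp_minus field_simps)
qed

section \<open>Products along a random permutation\<close>

lemma avg_permutes_compose_right:
  assumes "\<tau> permutes P"
  shows "avg {\<sigma>. \<sigma> permutes P} (\<lambda>\<sigma>. f (\<sigma> \<circ> \<tau>)) = avg {\<sigma>. \<sigma> permutes P} f"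
  unfolding avg_def using sum_permutations_compose_right[OF assms, of f] by simp

lemma permutes_set_nonempty: "{\<sigma>. \<sigma> permutes P} \<noteq> {}"
  using permutes_id[of P] by blast

text \<open>The expectation of the product over \<open>insert l K\<close> does not exceed that of the product over \<open>K\<close>
  with one factor \<open>i \<in> K\<close> squared: exchanging \<open>i\<close> and \<open>l\<close> turns twice the difference into the
  average of \<open>(u (\<sigma> i) - u (\<sigma> l))\<^sup>2\<close> times a nonnegative product.\<close>

lemma avg_permutes_prod_le:
  fixes u :: "'a \<Rightarrow> real"
  assumes P: "finite P" "P \<noteq> {}" and u: "\<And>k. k \<in> P \<Longrightarrow> 0 \<le> u k" and "K \<subseteq> P"
  shows "avg {\<sigma>. \<sigma> permutes P} (\<lambda>\<sigma>. \<Prod>k\<in>K. u (\<sigma> k)) \<le> (avg P u) ^ card K"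
proof -
  let ?S = "{\<sigma>. \<sigma> permutes P}"
  have upos: "0 \<le> u (\<sigma> k)" if "\<sigma> \<in> ?S" "k \<in> P" for \<sigma> k
    using u that permutes_in_image by fastforce
  have "finite K" using assms finite_subset by auto
  then show ?thesis using \<open>K \<subseteq> P\<close>
  proof (induction K rule: finite_induct)
    case empty
    then show ?case using permutes_set_nonempty[of P] P
      by (simp add: avg_const finite_permutations)
  next
    case (insert l K)
    define Q where "Q \<sigma> = (\<Prod>k\<in>K. u (\<sigma> k))" for \<sigma>
    have K: "K \<subseteq> P" "l \<in> P" "l \<notin> K" "finite K" using insert by auto
    have Qpos: "0 \<le> Q \<sigma>" if "\<sigma> \<in> ?S" for \<sigma>
      unfolding Q_def using upos that K by (intro prod_nonneg) auto
    define \<alpha> where "\<alpha> = avg ?S (\<lambda>\<sigma>. Q \<sigma> * u (\<sigma> l))"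
    have swap: "avg ?S (\<lambda>\<sigma>. f (\<sigma> \<circ> Transposition.transpose i l)) = avg ?S f" if "i \<in> P" for i and f :: "_ \<Rightarrow> real"
      by (rule avg_permutes_compose_right) (use that K in \<open>auto intro: permutes_swap_id\<close>)
    have ge: "\<alpha> \<le> avg ?S (\<lambda>\<sigma>. Q \<sigma> * u (\<sigma> i))" if i: "i \<in> P" for i
    proof (cases "i \<in> K")
      case False
      have "Q (\<sigma> \<circ> Transposition.transpose i l) = Q \<sigma>" for \<sigma>
        unfolding Q_def using False K by (intro prod.cong) (auto simp: Transposition.transpose_def)
      then have "avg ?S (\<lambda>\<sigma>. Q \<sigma> * u (\<sigma> i)) = \<alpha>"
        unfolding \<alpha>_def using swap[OF i, of "\<lambda>\<sigma>. Q \<sigma> * u (\<sigma> l)"] by simp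
      then show ?thesis by simp
    next
      case True
      define R where "R \<sigma> = (\<Prod>k\<in>K-{i}. u (\<sigma> k))" for \<sigma>
      have Q: "Q \<sigma> = u (\<sigma> i) * R \<sigma>" for \<sigma>
        unfolding Q_def R_def using True K by (intro prod.remove) auto
      have R: "R (\<sigma> \<circ> Transposition.transpose i l) = R \<sigma>" for \<sigma>
        unfolding R_def using K by (intro prod.cong) (auto simp: Transposition.transpose_def)
      have Rpos: "0 \<le> R \<sigma>" if "\<sigma> \<in> ?S" for \<sigma>
        unfolding R_def using upos that K by (intro prod_nonneg) auto
      let ?D = "\<lambda>\<sigma>. R \<sigma> * u (\<sigma> i) * (u (\<sigma> i) - u (\<sigma> l))"
      have "2 * avg ?S ?D = avg ?S ?D + avg ?S (\<lambda>\<sigma>. ?D (\<sigma> \<circ> Transposition.transpose i l))"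
        using swap[OF i, of ?D] by simp
      also have "\<dots> = avg ?S (\<lambda>\<sigma>. R \<sigma> * (u (\<sigma> i) - u (\<sigma> l))\<^sup>2)"
        unfolding avg_add[symmetric] R
        by (rule avg_cong) (simp add: algebra_simps power2_eq_square)
      also have "0 \<le> \<dots>" using Rpos by (intro avg_nonneg) auto
      finally have "0 \<le> avg ?S ?D" by simp
      also have "avg ?S ?D = avg ?S (\<lambda>\<sigma>. Q \<sigma> * u (\<sigma> i)) - \<alpha>"
        unfolding \<alpha>_def avg_diff[symmetric] Q by (rule avg_cong) (simp add: algebra_simps)
      finally show ?thesis by simp
    qed
    \<comment> \<open>Summing over all i in P turns the last factor into the sum of u over P, which
      does not depend on the permutation and leaves the average.\<close>
    have "real (card P) * \<alpha> \<le> (\<Sum>i\<in>P. avg ?S (\<lambda>\<sigma>. Q \<sigma> * u (\<sigma> i)))"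
      using sum_mono[of P "\<lambda>_. \<alpha>", OF ge] by simp
    also have "\<dots> = avg ?S (\<lambda>\<sigma>. Q \<sigma> * (\<Sum>i\<in>P. u (\<sigma> i)))"
      unfolding avg_sum[symmetric] by (simp add: sum_distrib_left)
    also have "\<dots> = avg ?S (\<lambda>\<sigma>. Q \<sigma> * (\<Sum>i\<in>P. u i))"
      by (rule avg_cong) (simp add: sum.permute[symmetric, unfolded o_def])
    also have "\<dots> = avg ?S Q * (\<Sum>i\<in>P. u i)" by (rule avg_mult_right)
    finally have "\<alpha> \<le> avg ?S Q * avg P u"
      using P by (simp add: avg_def[of P] field_simps card_gt_0_iff)
    also have "\<dots> \<le> avg P u ^ card K * avg P u"
      using insert.IH K u unfolding Q_def by (intro mult_right_mono avg_nonneg) auto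
    finally show ?case
      using K by (simp add: \<alpha>_def Q_def mult.commute)
  qed
qed

text \<open>Expanding over subsets of P gives nonnegative coefficients times pure products, so the
  product bound applies term by term. The right side is what independent uniform draws from P would
  give. Affine factors are exactly what linear upper bounds on exponentials produce.\<close>

lemma avg_permutes_prod_affine_le:
  fixes u :: "'a \<Rightarrow> real"
  assumes P: "finite P" "P \<noteq> {}" and u: "\<And>k. k \<in> P \<Longrightarrow> 0 \<le> u k"
    and \<alpha>: "\<And>k. k \<in> P \<Longrightarrow> 0 \<le> \<alpha> k" and \<beta>: "\<And>k. k \<in> P \<Longrightarrow> 0 \<le> \<beta> k"
  shows "avg {\<sigma>. \<sigma> permutes P} (\<lambda>\<sigma>. \<Prod>k\<in>P. \<alpha> k + \<beta> k * u (\<sigma> k))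
    \<le> (\<Prod>k\<in>P. \<alpha> k + \<beta> k * avg P u)"
proof -
  let ?S = "{\<sigma>. \<sigma> permutes P}"
  have "avg ?S (\<lambda>\<sigma>. \<Prod>k\<in>P. \<alpha> k + \<beta> k * u (\<sigma> k))
     = avg ?S (\<lambda>\<sigma>. \<Sum>X\<in>Pow P. (\<Prod>k\<in>P - X. \<alpha> k) * (\<Prod>k\<in>X. \<beta> k) * (\<Prod>k\<in>X. u (\<sigma> k)))"
    by (subst add.commute) (simp add: prod_add[OF P(1)] prod.distrib mult_ac)
  also have "\<dots> = (\<Sum>X\<in>Pow P. (\<Prod>k\<in>P - X. \<alpha> k) * (\<Prod>k\<in>X. \<beta> k) * avg ?S (\<lambda>\<sigma>. \<Prod>k\<in>X. u (\<sigma> k)))"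
    by (simp add: avg_sum avg_mult_left)
  also have "\<dots> \<le> (\<Sum>X\<in>Pow P. (\<Prod>k\<in>P - X. \<alpha> k) * (\<Prod>k\<in>X. \<beta> k) * (avg P u) ^ card X)"
    using \<alpha> \<beta> by (intro sum_mono mult_left_mono avg_permutes_prod_le P u)
      (auto intro!: mult_nonneg_nonneg prod_nonneg)
  also have "\<dots> = (\<Prod>k\<in>P. \<beta> k * avg P u + \<alpha> k)"
    by (simp add: prod_add[OF P(1)] prod.distrib mult_ac)
  finally show ?thesis by (simp add: add.commute)
qed

section \<open>Rademacher sums\<close>

text \<open>The two power series are compared term by term, using 2^n n! <= (2n)!.\<close>

lemma cosh_le_exp_half_square: "cosh x \<le> exp (x\<^sup>2 / 2)" for x :: real
proof -
  have "(\<lambda>n. if even n then x ^ n /\<^sub>R fact n else 0) sums cosh x"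
    by (rule cosh_converges)
  then have "(\<lambda>n. (if even (2 * n) then x ^ (2 * n) /\<^sub>R fact (2 * n) else 0)) sums cosh x"
    by (subst sums_mono_reindex[of "\<lambda>n. 2 * n"]) (auto simp: strict_mono_def elim!: evenE)
  then have s: "(\<lambda>n. x ^ (2 * n) / fact (2 * n)) sums cosh x"
    by (simp add: field_simps)
  have e: "(\<lambda>n. (x\<^sup>2 / 2) ^ n /\<^sub>R fact n) sums exp (x\<^sup>2 / 2)" by (rule exp_converges)
  have fact: "2 ^ n * fact n \<le> (fact (2 * n) :: real)" for n
  proof (induction n)
    case (Suc n)
    have "2 ^ Suc n * fact (Suc n) = (2 * (real n + 1)) * (2 ^ n * fact n)" by (simp add: algebra_simps)
    also have "\<dots> \<le> (2 * (real n + 1)) * fact (2 * n)" using Suc by (intro mult_left_mono) auto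
    also have "\<dots> \<le> (2 * real n + 2) * ((2 * real n + 1) * fact (2 * n))"
      by (simp add: algebra_simps)
    also have "\<dots> = fact (2 * Suc n)" by (simp add: algebra_simps)
    finally show ?case .
  qed simp
  show ?thesis
  proof (rule sums_le[OF _ s e])
    fix n
    have "x ^ (2 * n) / fact (2 * n) \<le> x ^ (2 * n) / (2 ^ n * fact n)"
      by (intro divide_left_mono fact) (auto simp: power_mult)
    also have "\<dots> = (x\<^sup>2 / 2) ^ n /\<^sub>R fact n"
      unfolding power_mult power_divide by (simp add: divide_inverse)
    finally show "x ^ (2 * n) / fact (2 * n) \<le> (x\<^sup>2 / 2) ^ n /\<^sub>R fact n" .
  qed
qed

lemma avg_signs_prod:
  fixes f :: "nat \<Rightarrow> real \<Rightarrow> real"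
  shows "avg (sign_vectors d) (\<lambda>\<xi>. \<Prod>k<d. f k (\<xi> k)) = (\<Prod>k<d. (f k 1 + f k (-1)) / 2)"
proof -
  have "(\<Sum>\<xi>\<in>sign_vectors d. \<Prod>k<d. f k (\<xi> k)) = (\<Prod>k<d. \<Sum>t\<in>{-1,1}. f k t)"
    unfolding sign_vectors_def by (subst prod_sum_PiE) auto
  moreover have "card (sign_vectors d) = 2 ^ d"
    unfolding sign_vectors_def by (simp add: card_PiE numeral_2_eq_2)
  ultimately show ?thesis
    unfolding avg_def by (simp add: prod_dividef add.commute)
qed

lemma sign_vectors_square:
  assumes "\<xi> \<in> sign_vectors d" "k < d"
  shows "\<xi> k * \<xi> k = 1"
  using PiE_mem[OF assms(1)[unfolded sign_vectors_def], of k] assms(2) by auto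

lemma rademacher_mgf:
  "avg (sign_vectors d) (\<lambda>\<xi>. exp (\<Sum>k<d. \<xi> k * c k)) \<le> exp ((\<Sum>k<d. (c k)\<^sup>2) / 2)"
proof -
  have "avg (sign_vectors d) (\<lambda>\<xi>. exp (\<Sum>k<d. \<xi> k * c k)) = (\<Prod>k<d. cosh (c k))"
    using avg_signs_prod[of d "\<lambda>k t. exp (t * c k)"] by (simp add: exp_sum cosh_field_def)
  also have "\<dots> \<le> (\<Prod>k<d. exp ((c k)\<^sup>2 / 2))"
    by (intro prod_mono) (auto simp: cosh_le_exp_half_square cosh_real_nonneg)
  also have "\<dots> = exp ((\<Sum>k<d. (c k)\<^sup>2) / 2)"
    by (simp add: exp_sum sum_divide_distrib)
  finally show ?thesis .
qed

text \<open>The exponent \<open>l\<close> stays free: in the cross terms the sum of squares is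
  itself random, and the last factor is averaged over permutations before it is bounded.\<close>

lemma rademacher_chernoff:
  assumes "0 < l"
  shows "freq (sign_vectors d) (\<lambda>\<xi>. t \<le> \<bar>\<Sum>k<d. \<xi> k * c k\<bar>)
    \<le> 2 * exp (- (l * t)) * exp (l\<^sup>2 / 2 * (\<Sum>k<d. (c k)\<^sup>2))"
proof -
  let ?A = "sign_vectors d" and ?E = "exp (- (l * t)) * exp (l\<^sup>2 / 2 * (\<Sum>k<d. (c k)\<^sup>2))"
  have one: "freq ?A (\<lambda>\<xi>. l * t \<le> (\<Sum>k<d. \<xi> k * (s * c k))) \<le> ?E"
    if s: "s\<^sup>2 = l\<^sup>2" for s :: real
  proof -
    have "freq ?A (\<lambda>\<xi>. l * t \<le> (\<Sum>k<d. \<xi> k * (s * c k)))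
      \<le> exp (- (l * t)) * avg ?A (\<lambda>\<xi>. exp (\<Sum>k<d. \<xi> k * (s * c k)))"
      by (rule freq_chernoff)
    also have "\<dots> \<le> exp (- (l * t)) * exp ((\<Sum>k<d. (s * c k)\<^sup>2) / 2)"
      by (intro mult_left_mono rademacher_mgf) simp
    also have "(\<Sum>k<d. (s * c k)\<^sup>2) / 2 = l\<^sup>2 / 2 * (\<Sum>k<d. (c k)\<^sup>2)"
      by (simp add: power_mult_distrib s sum_distrib_left[symmetric])
    finally show ?thesis .
  qed
  have "freq ?A (\<lambda>\<xi>. t \<le> \<bar>\<Sum>k<d. \<xi> k * c k\<bar>)
     \<le> freq ?A (\<lambda>\<xi>. l * t \<le> (\<Sum>k<d. \<xi> k * (l * c k)) \<or> l * t \<le> (\<Sum>k<d. \<xi> k * (- l * c k)))"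
  proof (rule freq_mono)
    fix \<xi> assume "t \<le> \<bar>\<Sum>k<d. \<xi> k * c k\<bar>"
    then have "t \<le> (\<Sum>k<d. \<xi> k * c k) \<or> t \<le> - (\<Sum>k<d. \<xi> k * c k)" by linarith
    then have "l * t \<le> l * (\<Sum>k<d. \<xi> k * c k) \<or> l * t \<le> l * - (\<Sum>k<d. \<xi> k * c k)"
      using assms by (simp only: mult_le_cancel_left_pos)
    then show "l * t \<le> (\<Sum>k<d. \<xi> k * (l * c k)) \<or> l * t \<le> (\<Sum>k<d. \<xi> k * (- l * c k))"
      by (simp add: sum_distrib_left mult_ac sum_negf)
  qed
  also have "\<dots> \<le> freq ?A (\<lambda>\<xi>. l * t \<le> (\<Sum>k<d. \<xi> k * (l * c k)))
     + freq ?A (\<lambda>\<xi>. l * t \<le> (\<Sum>k<d. \<xi> k * (- l * c k)))"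
    by (rule freq_disj_le)
  also have "\<dots> \<le> ?E + ?E" by (intro add_mono one) auto
  finally show ?thesis by simp
qed

lemma rademacher_tail:
  assumes "(\<Sum>k<d. (c k)\<^sup>2) \<le> V" "0 < V" "0 < t"
  shows "freq (sign_vectors d) (\<lambda>\<xi>. sqrt (2 * V * t) \<le> \<bar>\<Sum>k<d. \<xi> k * c k\<bar>) \<le> 2 * exp (- t)"
proof -
  \<comment> \<open>The minimiser of l^2 V / 2 - l sqrt(2 V t), with minimum -t.\<close>
  let ?l = "sqrt (2 * t / V)"
  have l: "?l * sqrt (2 * V * t) = 2 * t"
    unfolding real_sqrt_mult[symmetric]
    using assms by (intro real_sqrt_unique) (auto simp: power2_eq_square field_simps)
  have l2: "?l\<^sup>2 = 2 * t / V" using assms by (intro real_sqrt_pow2) auto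
  have "freq (sign_vectors d) (\<lambda>\<xi>. sqrt (2 * V * t) \<le> \<bar>\<Sum>k<d. \<xi> k * c k\<bar>)
      \<le> 2 * exp (- (?l * sqrt (2 * V * t))) * exp (?l\<^sup>2 / 2 * (\<Sum>k<d. (c k)\<^sup>2))"
    using assms by (intro rademacher_chernoff) auto
  also have "\<dots> \<le> 2 * exp (- (2 * t)) * exp t"
  proof -
    have "t / V * (\<Sum>k<d. (c k)\<^sup>2) \<le> t / V * V"
      using assms by (intro mult_left_mono) auto
    then show ?thesis unfolding l l2 using assms by simp
  qed
  also have "\<dots> = 2 * exp (- t)" by (simp add: exp_add[symmetric])
  finally show ?thesis .
qed

text \<open>This symmetry replaces independence in the second moment: flipping one coordinate
  negates a mixed product, whose average is therefore 0.\<close>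

lemma avg_sign_flip_coord:
  assumes "k < d"
  shows "avg (sign_vectors d) (\<lambda>\<xi>. f (\<xi>(k := - \<xi> k))) = avg (sign_vectors d) f"
proof -
  let ?h = "\<lambda>\<xi>. \<xi>(k := - \<xi> k) :: nat \<Rightarrow> real"
  have *: "?h \<xi> \<in> sign_vectors d" if "\<xi> \<in> sign_vectors d" for \<xi>
    unfolding sign_vectors_def
  proof (rule PiE_I)
    show "?h \<xi> i \<in> {-1, 1}" if "i \<in> {..<d}" for i
      using that PiE_mem[OF \<open>\<xi> \<in> sign_vectors d\<close>[unfolded sign_vectors_def], of i] by auto
    show "?h \<xi> i = undefined" if "i \<notin> {..<d}" for i
      using that assms PiE_arb[OF \<open>\<xi> \<in> sign_vectors d\<close>[unfolded sign_vectors_def], of i] by auto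
  qed
  have "bij_betw ?h (sign_vectors d) (sign_vectors d)"
    by (rule bij_betw_byWitness[where f' = ?h]) (use * in auto)
  then show ?thesis by (rule avg_reindex_bij)
qed

lemma rademacher_second_moment:
  "avg (sign_vectors d) (\<lambda>\<xi>. (\<Sum>k<d. \<xi> k * c k)\<^sup>2) = (\<Sum>k<d. (c k)\<^sup>2)"
proof -
  let ?A = "sign_vectors d"
  have corr: "avg ?A (\<lambda>\<xi>. \<xi> k * \<xi> l) = of_bool (k = l)" if kl: "k < d" "l < d" for k l
  proof (cases "k = l")
    case True
    have "avg ?A (\<lambda>\<xi>. \<xi> k * \<xi> k) = avg ?A (\<lambda>_. 1)"
      using kl by (intro avg_cong) (simp add: sign_vectors_square)
    then show ?thesis using True sign_vectors_finite_nonempty[of d] by (simp add: avg_const)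
  next
    case False
    have "avg ?A (\<lambda>\<xi>. - 1 * (\<xi> k * \<xi> l)) = avg ?A (\<lambda>\<xi>. \<xi> k * \<xi> l)"
      using avg_sign_flip_coord[OF kl(1), of "\<lambda>\<xi>. \<xi> k * \<xi> l"] False by simp
    then show ?thesis unfolding avg_mult_left using False by simp
  qed
  have "avg ?A (\<lambda>\<xi>. (\<Sum>k<d. \<xi> k * c k)\<^sup>2) = avg ?A (\<lambda>\<xi>. \<Sum>k<d. \<Sum>l<d. c k * c l * (\<xi> k * \<xi> l))"
    by (simp add: power2_eq_square sum_product mult_ac)
  also have "\<dots> = (\<Sum>k<d. \<Sum>l<d. c k * c l * of_bool (k = l))"
    by (simp add: avg_sum avg_mult_left corr)
  also have "\<dots> = (\<Sum>k<d. (c k)\<^sup>2)"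
    by (intro sum.cong) (auto simp: power2_eq_square of_bool_def if_distrib cong: if_cong)
  finally show ?thesis .
qed

lemma exp_minus_le_quadratic: "exp (- x) \<le> 1 - x + x\<^sup>2" if "0 \<le> x" for x :: real
proof -
  have "exp (- x) = inverse (exp x)" by (rule exp_minus)
  also have "\<dots> \<le> inverse (1 + x)"
    using that by (intro le_imp_inverse_le) auto
  also have "\<dots> \<le> 1 - x + x\<^sup>2"
  proof -
    have "1 \<le> 1 + x ^ 3" using that by simp
    also have "\<dots> = (1 - x + x\<^sup>2) * (1 + x)"
      by (simp add: algebra_simps power2_eq_square power3_eq_cube)
    finally show ?thesis using that by (simp add: inverse_eq_divide pos_divide_le_eq)
  qed
  finally show ?thesis .
qed

text \<open>A substitute for conditioning: if every transformation \<open>h \<omega>\<close>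
  preserves averages over A, an average over \<omega> may be inserted. The inner average, with x
  fixed, then acts as a conditional expectation given whatever \<open>h\<close> leaves
  unchanged.\<close>

lemma avg_invariant_resample:
  assumes "finite T" "T \<noteq> {}" "\<And>\<omega>. \<omega> \<in> T \<Longrightarrow> avg A (\<lambda>x. F (h \<omega> x)) = avg A F"
  shows "avg A F = avg A (\<lambda>x. avg T (\<lambda>\<omega>. F (h \<omega> x)))"
proof -
  have "avg A (\<lambda>x. avg T (\<lambda>\<omega>. F (h \<omega> x))) = avg T (\<lambda>\<omega>. avg A (\<lambda>x. F (h \<omega> x)))"
    by (rule avg_swap)
  also have "\<dots> = avg T (\<lambda>_. avg A F)" by (rule avg_cong) (rule assms(3))
  finally show ?thesis using assms by (simp add: avg_const)
qed

text \<open>Signs are extensional functions, so the transformation must leave the value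
  \<open>undefined\<close> outside \<open>{..<d}\<close> alone; hence a case distinction instead of
  a pointwise product.\<close>

lemma bij_betw_sign_mult:
  assumes "\<zeta> \<in> sign_vectors d" "S \<subseteq> {..<d}"
  shows "bij_betw (\<lambda>\<xi> k. if k \<in> S then \<zeta> k * \<xi> k else \<xi> k) (sign_vectors d) (sign_vectors d)"
proof -
  let ?h = "\<lambda>\<xi> k. if k \<in> S then \<zeta> k * \<xi> k else \<xi> k"
  have *: "?h \<xi> \<in> sign_vectors d" if "\<xi> \<in> sign_vectors d" for \<xi>
    unfolding sign_vectors_def
  proof (rule PiE_I)
    fix k assume "k \<in> {..<d}"
    then show "?h \<xi> k \<in> {-1, 1}"
      using PiE_mem[OF assms(1)[unfolded sign_vectors_def], of k]
        PiE_mem[OF that[unfolded sign_vectors_def], of k] by auto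
  next
    fix k assume "k \<notin> {..<d}"
    then show "?h \<xi> k = undefined"
      using assms(2) PiE_arb[OF that[unfolded sign_vectors_def], of k] by auto
  qed
  have **: "?h (?h \<xi>) = \<xi>" for \<xi>
  proof
    fix k show "?h (?h \<xi>) k = \<xi> k"
      using assms sign_vectors_square[OF assms(1), of k]
      by (auto simp: mult.assoc[symmetric])
  qed
  show ?thesis
    by (rule bij_betw_byWitness[where f' = ?h]) (use * ** in auto)
qed

section \<open>The chaos of a delocalised vector\<close>

text \<open>The situation after \<xi>' has been fixed at a good value: \<open>y\<close> is B
  D_\<xi>' x before permutation, and \<open>w j k\<close> is entry j of the column w_k.
  \<open>dual_le\<close> bounds the squared operator norm of this matrix by d/m. The constant 144 of
  the theorem appears as 72 because b will be 2 a times the squared maximum norm of B.\<close>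

locale sampled_chaos =
  fixes d :: nat and I :: "'i set" and w :: "'i \<Rightarrow> nat \<Rightarrow> real" and y :: "nat \<Rightarrow> real"
    and m a \<kappa> b :: real
  assumes finite_I: "finite I"
    and y_unit: "(\<Sum>k<d. (y k)\<^sup>2) = 1"
    and y_le: "k < d \<Longrightarrow> (y k)\<^sup>2 \<le> b"
    and col_le: "k < d \<Longrightarrow> (\<Sum>j\<in>I. (w j k)\<^sup>2) \<le> \<kappa>"
    and col_sum: "(\<Sum>k<d. \<Sum>j\<in>I. (w j k)\<^sup>2) = real d"
    and dual_le: "(\<Sum>k<d. (\<Sum>j\<in>I. w j k * v j)\<^sup>2) \<le> real d / m * (\<Sum>j\<in>I. (v j)\<^sup>2)"
    and m_le: "m \<le> real d"
    and a_ge: "1 \<le> a"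
    and m_ge: "2025 * a \<le> m"
    and flat: "72 * (\<kappa> * b) * m * a \<le> 1"
begin

abbreviation "signs \<equiv> sign_vectors d"
abbreviation "perms \<equiv> {\<pi>. \<pi> permutes {..<d}}"

definition r :: real where "r = sqrt (a / m)"
text \<open>The common Chernoff exponent: since \<theta> r = a, a deviation of c r is paid for by
  exp(-c a).\<close>

definition \<theta> :: real where "\<theta> = sqrt (m * a)"
definition g :: "nat \<Rightarrow> real" where "g k = (\<Sum>j\<in>I. (w j k)\<^sup>2)"
definition V :: "nat set \<Rightarrow> (nat \<Rightarrow> real) \<Rightarrow> (nat \<Rightarrow> nat) \<Rightarrow> 'i \<Rightarrow> real" where
  "V S \<xi> \<pi> j = (\<Sum>k\<in>S. \<xi> k * y (\<pi> k) * w j k)"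
definition N :: "nat set \<Rightarrow> (nat \<Rightarrow> real) \<Rightarrow> (nat \<Rightarrow> nat) \<Rightarrow> real" where
  "N S \<xi> \<pi> = (\<Sum>j\<in>I. (V S \<xi> \<pi> j)\<^sup>2)"
definition X :: "(nat \<Rightarrow> real) \<Rightarrow> (nat \<Rightarrow> nat) \<Rightarrow> real" where
  "X \<xi> \<pi> = N {..<d} \<xi> \<pi>"
definition tr :: "(nat \<Rightarrow> nat) \<Rightarrow> real" where
  "tr \<pi> = (\<Sum>k<d. g k * (y (\<pi> k))\<^sup>2)"

lemma d_pos: "0 < d"
  using m_le m_ge a_ge by (cases d) auto

lemma m_pos: "0 < m"
  using m_ge a_ge by linarith

lemma g_nonneg: "0 \<le> g k"
  unfolding g_def by (intro sum_nonneg) auto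

lemma b_nonneg: "0 \<le> b"
  using y_le[OF d_pos] by (meson order_trans zero_le_power2)

lemma kappa_nonneg: "0 \<le> \<kappa>"
  using col_le[OF d_pos] g_nonneg[of 0] unfolding g_def by linarith

lemma theta_square: "\<theta> * \<theta> = m * a"
  unfolding \<theta>_def using m_pos a_ge by simp

lemma theta_ge: "1 \<le> \<theta>"
proof -
  have "1 \<le> m * a" using mult_mono[of 1 m 1 a] m_ge a_ge by simp
  then show ?thesis unfolding \<theta>_def by simp
qed

lemma theta_r: "\<theta> * r = a"
  unfolding \<theta>_def r_def real_sqrt_mult[symmetric]
  using m_pos a_ge by (intro real_sqrt_unique) (auto simp: power2_eq_square)

lemma r_nonneg: "0 \<le> r"
  unfolding r_def using m_pos a_ge by simp

lemma r_le: "r \<le> 1 / 45"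
proof -
  have "a / m \<le> (1 / 45)\<^sup>2" using m_ge m_pos by (simp add: field_simps power2_eq_square)
  then show ?thesis unfolding r_def by (intro real_le_lsqrt) auto
qed

text \<open>In \<open>X_deviation\<close> the exceptional sign patterns contribute at most d / d^2 =
  1/d, which this absorbs into the error r.\<close>

lemma r_ge: "1 / real d \<le> r"
proof -
  have "(1 / real d)\<^sup>2 \<le> 1 / real d"
    using d_pos by (simp add: power2_eq_square field_simps)
  also have "\<dots> \<le> a / m" using m_pos a_ge m_le d_pos by (intro frac_le) auto
  finally show ?thesis unfolding r_def using real_le_rsqrt by blast
qed

lemma flat_theta: "\<theta> * (\<theta> * (\<kappa> * b)) \<le> 1 / 72"
proof -
  have "\<theta> * (\<theta> * (\<kappa> * b)) = \<theta> * \<theta> * (\<kappa> * b)" by (simp only: mult.assoc)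
  also have "\<dots> = (\<kappa> * b) * m * a" unfolding theta_square by (simp only: mult_ac)
  finally show ?thesis using flat by linarith
qed

lemma flat_theta1: "\<theta> * (\<kappa> * b) \<le> 1 / 72"
proof -
  have "1 * (\<theta> * (\<kappa> * b)) \<le> \<theta> * (\<theta> * (\<kappa> * b))"
    using theta_ge kappa_nonneg b_nonneg by (intro mult_right_mono mult_nonneg_nonneg) auto
  then show ?thesis using flat_theta by simp
qed

lemma perm_lt: "\<pi> \<in> perms \<Longrightarrow> k < d \<Longrightarrow> \<pi> k < d"
  using permutes_in_image[of \<pi> "{..<d}" k] by auto

lemma perms_finite: "finite perms" "perms \<noteq> {}"
  using permutations_finite_nonempty by auto

lemmas signs_finite = sign_vectors_finite_nonempty[of d]

section \<open>Concentration of the diagonal part over the permutation\<close>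

lemma avg_y_square: "avg {..<d} (\<lambda>k. (y k)\<^sup>2) = 1 / d"
  unfolding avg_def using y_unit by simp

lemma sum_g: "(\<Sum>k<d. g k) = d"
  unfolding g_def by (rule col_sum)

lemma col_term_le:
  assumes "k < d" "l < d"
  shows "\<theta> * (g k * (y l)\<^sup>2) \<le> \<theta> * (\<kappa> * b)"
  using assms theta_ge col_le y_le g_nonneg kappa_nonneg unfolding g_def
  by (intro mult_left_mono mult_mono) auto

text \<open>Each term of \<theta> \<open>tr\<close> lies between 0 and \<beta>, so exp x <= 1 + x +
  x^2 <= 1 + (1 + \<beta>) x makes the factors affine. The total exponent is \<theta> \<beta> - 2 a,
  and \<theta> \<beta> <= 1/72 <= a.\<close>

lemma trace_upper: "freq perms (\<lambda>\<pi>. 1 + 2 * r \<le> tr \<pi>) \<le> exp (- a)"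
proof -
  define \<beta> where "\<beta> = \<theta> * (\<kappa> * b)"
  have \<beta>: "0 \<le> \<beta>" "\<beta> \<le> 1"
    using flat_theta1 theta_ge kappa_nonneg b_nonneg unfolding \<beta>_def by auto
  have "freq perms (\<lambda>\<pi>. 1 + 2 * r \<le> tr \<pi>) = freq perms (\<lambda>\<pi>. \<theta> * (1 + 2 * r) \<le> \<theta> * tr \<pi>)"
    using theta_ge by simp
  also have "\<dots> \<le> exp (- (\<theta> * (1 + 2 * r))) * avg perms (\<lambda>\<pi>. exp (\<theta> * tr \<pi>))"
    by (rule freq_chernoff)
  also have "avg perms (\<lambda>\<pi>. exp (\<theta> * tr \<pi>))
      \<le> avg perms (\<lambda>\<pi>. \<Prod>k<d. 1 + \<theta> * (1 + \<beta>) * g k * (y (\<pi> k))\<^sup>2)"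
  proof (rule avg_mono)
    fix \<pi> assume \<pi>: "\<pi> \<in> perms"
    have "exp (\<theta> * tr \<pi>) = (\<Prod>k<d. exp (\<theta> * (g k * (y (\<pi> k))\<^sup>2)))"
      unfolding tr_def by (simp add: sum_distrib_left exp_sum)
    also have "\<dots> \<le> (\<Prod>k<d. 1 + \<theta> * (1 + \<beta>) * g k * (y (\<pi> k))\<^sup>2)"
    proof (intro prod_mono conjI)
      fix k assume k: "k \<in> {..<d}"
      let ?x = "\<theta> * (g k * (y (\<pi> k))\<^sup>2)"
      have x: "0 \<le> ?x" "?x \<le> \<beta>"
        using theta_ge g_nonneg col_term_le[of k "\<pi> k"] perm_lt[OF \<pi>] k unfolding \<beta>_def by auto
      have "exp ?x \<le> 1 + ?x + ?x\<^sup>2" using x \<beta> by (intro exp_bound) auto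
      also have "?x\<^sup>2 \<le> ?x * \<beta>" unfolding power2_eq_square[of ?x] using x by (intro mult_left_mono)
      finally show "exp ?x \<le> 1 + \<theta> * (1 + \<beta>) * g k * (y (\<pi> k))\<^sup>2" by (simp add: algebra_simps)
    qed simp
    finally show "exp (\<theta> * tr \<pi>) \<le> (\<Prod>k<d. 1 + \<theta> * (1 + \<beta>) * g k * (y (\<pi> k))\<^sup>2)" .
  qed
  also have "\<dots> \<le> (\<Prod>k<d. 1 + \<theta> * (1 + \<beta>) * g k * avg {..<d} (\<lambda>k. (y k)\<^sup>2))"
    using avg_permutes_prod_affine_le[of "{..<d}" "\<lambda>k. (y k)\<^sup>2" "\<lambda>_. 1" "\<lambda>k. \<theta> * (1 + \<beta>) * g k"]
      d_pos theta_ge g_nonneg \<beta> by auto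
  also have "\<dots> \<le> (\<Prod>k<d. exp (\<theta> * (1 + \<beta>) * g k / d))"
    unfolding avg_y_square using theta_ge g_nonneg \<beta>
    by (intro prod_mono conjI) (auto intro!: add_nonneg_nonneg)
  also have "\<dots> = exp (\<theta> * (1 + \<beta>))"
    using sum_g d_pos
    by (simp add: exp_sum[symmetric] sum_divide_distrib[symmetric] sum_distrib_left[symmetric])
  finally have "freq perms (\<lambda>\<pi>. 1 + 2 * r \<le> tr \<pi>) \<le> exp (- (\<theta> * (1 + 2 * r)) + \<theta> * (1 + \<beta>))"
    unfolding exp_add by simp
  also have "- (\<theta> * (1 + 2 * r)) + \<theta> * (1 + \<beta>) = \<theta> * \<beta> - 2 * a"
    using theta_r by (simp add: algebra_simps)
  also have "exp (\<theta> * \<beta> - 2 * a) \<le> exp (- a)"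
    using flat_theta a_ge unfolding \<beta>_def by simp
  finally show ?thesis .
qed

text \<open>The factors \<open>1 - c u\<close> are decreasing in \<open>u\<close>; since \<open>c * b \<le> 1\<close> they are nonnegative
  combinations of \<open>1\<close> and \<open>b - u\<close>, to which the product bound applies.\<close>

lemma trace_lower: "freq perms (\<lambda>\<pi>. tr \<pi> \<le> 1 - 2 * r) \<le> exp (- a)"
proof -
  define \<beta> where "\<beta> = \<theta> * (\<kappa> * b)"
  have \<beta>: "0 \<le> \<beta>" "\<beta> \<le> 1"
    using flat_theta1 theta_ge kappa_nonneg b_nonneg unfolding \<beta>_def by auto
  define c where "c k = \<theta> * (1 - \<beta>) * g k" for k
  have c_nonneg: "0 \<le> c k" for k
    unfolding c_def using \<beta> theta_ge g_nonneg by auto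
  have c_b: "c k * b \<le> 1" if "k < d" for k
  proof -
    have "c k * b = (1 - \<beta>) * (\<theta> * (g k * b))" by (simp add: c_def)
    also have "\<dots> \<le> 1 * (\<theta> * (\<kappa> * b))"
      using \<beta> theta_ge g_nonneg b_nonneg kappa_nonneg col_le[OF that] unfolding g_def[symmetric]
      by (intro mult_mono mult_nonneg_nonneg) auto
    finally show ?thesis using \<beta> unfolding \<beta>_def by simp
  qed
  have "freq perms (\<lambda>\<pi>. tr \<pi> \<le> 1 - 2 * r) = freq perms (\<lambda>\<pi>. - (\<theta> * (1 - 2 * r)) \<le> - (\<theta> * tr \<pi>))"
    using theta_ge by simp
  also have "\<dots> \<le> exp (- (- (\<theta> * (1 - 2 * r)))) * avg perms (\<lambda>\<pi>. exp (- (\<theta> * tr \<pi>)))"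
    by (rule freq_chernoff)
  also have "avg perms (\<lambda>\<pi>. exp (- (\<theta> * tr \<pi>)))
      \<le> avg perms (\<lambda>\<pi>. \<Prod>k<d. (1 - c k * b) + c k * (b - (y (\<pi> k))\<^sup>2))"
  proof (rule avg_mono)
    fix \<pi> assume \<pi>: "\<pi> \<in> perms"
    have "exp (- (\<theta> * tr \<pi>)) = (\<Prod>k<d. exp (- (\<theta> * (g k * (y (\<pi> k))\<^sup>2))))"
      unfolding tr_def by (simp add: sum_distrib_left sum_negf[symmetric] exp_sum)
    also have "\<dots> \<le> (\<Prod>k<d. (1 - c k * b) + c k * (b - (y (\<pi> k))\<^sup>2))"
    proof (intro prod_mono conjI)
      fix k assume k: "k \<in> {..<d}"
      let ?x = "\<theta> * (g k * (y (\<pi> k))\<^sup>2)"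
      have x: "0 \<le> ?x" "?x \<le> \<beta>"
        using theta_ge g_nonneg col_term_le[of k "\<pi> k"] perm_lt[OF \<pi>] k unfolding \<beta>_def by auto
      have "exp (- ?x) \<le> 1 - ?x + ?x\<^sup>2" using x by (intro exp_minus_le_quadratic) auto
      also have "?x\<^sup>2 \<le> ?x * \<beta>" unfolding power2_eq_square[of ?x] using x by (intro mult_left_mono)
      finally show "exp (- ?x) \<le> (1 - c k * b) + c k * (b - (y (\<pi> k))\<^sup>2)"
        by (simp add: algebra_simps c_def)
    qed simp
    finally show "exp (- (\<theta> * tr \<pi>)) \<le> (\<Prod>k<d. (1 - c k * b) + c k * (b - (y (\<pi> k))\<^sup>2))" .
  qed
  also have "\<dots> \<le> (\<Prod>k<d. (1 - c k * b) + c k * avg {..<d} (\<lambda>k. b - (y k)\<^sup>2))"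
    using avg_permutes_prod_affine_le[of "{..<d}" "\<lambda>k. b - (y k)\<^sup>2" "\<lambda>k. 1 - c k * b" c]
      d_pos c_nonneg c_b y_le by auto
  also have "avg {..<d} (\<lambda>k. b - (y k)\<^sup>2) = b - 1 / d"
    using d_pos avg_y_square avg_const[of "{..<d}" b] by (auto simp: avg_diff)
  also have "(\<Prod>k<d. (1 - c k * b) + c k * (b - 1 / d)) \<le> (\<Prod>k<d. exp (- (c k / d)))"
  proof (intro prod_mono conjI)
    fix k assume k: "k \<in> {..<d}"
    have "1 / real d = avg {..<d} (\<lambda>k. (y k)\<^sup>2)" by (simp add: avg_y_square)
    also have "\<dots> \<le> b" using y_le d_pos by (intro avg_le_const) auto
    finally show "0 \<le> (1 - c k * b) + c k * (b - 1 / d)"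
      using c_nonneg c_b k by (intro add_nonneg_nonneg mult_nonneg_nonneg) auto
    show "(1 - c k * b) + c k * (b - 1 / d) \<le> exp (- (c k / d))"
      using exp_ge_add_one_self[of "- (c k / d)"] by (simp add: algebra_simps)
  qed
  also have "\<dots> = exp (- (\<theta> * (1 - \<beta>)))"
    using sum_g d_pos unfolding c_def
    by (simp add: exp_sum[symmetric] sum_negf sum_divide_distrib[symmetric] sum_distrib_left[symmetric])
  finally have "freq perms (\<lambda>\<pi>. tr \<pi> \<le> 1 - 2 * r) \<le> exp (- (- (\<theta> * (1 - 2 * r))) + - (\<theta> * (1 - \<beta>)))"
    unfolding exp_add by simp
  also have "- (- (\<theta> * (1 - 2 * r))) + - (\<theta> * (1 - \<beta>)) = \<theta> * \<beta> - 2 * a"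
    using theta_r by (simp add: algebra_simps)
  also have "exp (\<theta> * \<beta> - 2 * a) \<le> exp (- a)"
    using flat_theta a_ge unfolding \<beta>_def by simp
  finally show ?thesis .
qed


section \<open>Cross terms between two complementary index sets\<close>

lemma sum_y_perm:
  assumes "\<pi> \<in> perms"
  shows "(\<Sum>k<d. (y (\<pi> k))\<^sup>2) = 1"
  using assms y_unit sum.permute[of \<pi> "{..<d}" "\<lambda>k. (y k)\<^sup>2"] by (simp add: o_def)

text \<open>Here \<open>h k\<close> will be <w_k, V>^2 / |V|^2, and m a / 2 is the \<theta>^2 / 2 of
  the Rademacher bound. As x <= 1 by flatness, exp x <= 1 + 2 x, which cancels the 1/2. The mean of
  the squared entries over S may exceed 1/d, but at most by a factor 2 because S holds at least half
  of the indices; that factor is the 2 in \<open>exp (2 * a)\<close>.\<close>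

lemma avg_perm_exp_le:
  assumes \<pi>: "\<pi> \<in> perms" and S: "S \<subseteq> {..<d}" "d \<le> 2 * card S"
    and h: "\<And>k. k < d \<Longrightarrow> 0 \<le> h k" "\<And>k. k < d \<Longrightarrow> h k \<le> \<kappa>" "(\<Sum>k<d. h k) \<le> d / m"
  shows "avg {\<sigma>. \<sigma> permutes S} (\<lambda>\<sigma>. exp (\<Sum>k\<in>S. m * a / 2 * h k * (y (\<pi> (\<sigma> k)))\<^sup>2)) \<le> exp (2 * a)"
proof -
  define u where "u k = (y (\<pi> k))\<^sup>2" for k
  have fin: "finite S" "S \<noteq> {}" using S d_pos finite_subset by auto
  have ma: "0 \<le> m * a" using m_pos a_ge by simp
  have factor_le: "exp (m * a / 2 * h k * u l) \<le> 1 + m * a * h k * u l" if "k < d" "l < d" for k l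
  proof -
    let ?x = "m * a / 2 * h k * u l"
    have u: "0 \<le> u l" "u l \<le> b" using y_le perm_lt[OF \<pi>] that by (auto simp: u_def)
    have "?x \<le> m * a / 2 * (\<kappa> * b)"
      unfolding mult.assoc[of _ "h k"] using u h that kappa_nonneg ma
      by (intro mult_left_mono mult_mono) auto
    also have "\<dots> \<le> 1" using flat by (simp add: mult_ac)
    finally have x: "?x \<le> 1" .
    have x0: "0 \<le> ?x" using u h that ma by (intro mult_nonneg_nonneg) auto
    have "exp ?x \<le> 1 + ?x + ?x\<^sup>2" using x x0 by (rule exp_bound[rotated])
    also have "?x\<^sup>2 \<le> ?x" using x x0 power_decreasing[of 1 2 ?x] by simp
    also have "1 + ?x + ?x = 1 + m * a * h k * u l" by (simp add: field_simps)
    finally show ?thesis by simp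
  qed
  have mah: "0 \<le> m * a * h k" if "k \<in> S" for k
    by (rule mult_nonneg_nonneg[OF ma]) (use that S h in auto)
  have in_S: "\<sigma> k \<in> S" if "\<sigma> permutes S" "k \<in> S" for \<sigma> k
    using that permutes_in_image by fastforce
  have "avg {\<sigma>. \<sigma> permutes S} (\<lambda>\<sigma>. exp (\<Sum>k\<in>S. m * a / 2 * h k * u (\<sigma> k)))
      \<le> avg {\<sigma>. \<sigma> permutes S} (\<lambda>\<sigma>. \<Prod>k\<in>S. 1 + m * a * h k * u (\<sigma> k))"
    unfolding exp_sum[OF fin(1)] using S in_S
    by (intro avg_mono prod_mono conjI factor_le) auto
  also have "\<dots> \<le> (\<Prod>k\<in>S. 1 + m * a * h k * avg S u)"
    using avg_permutes_prod_affine_le[of S u "\<lambda>_. 1" "\<lambda>k. m * a * h k", OF fin _ _ mah]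
    by (simp add: u_def)
  also have "\<dots> \<le> (\<Prod>k\<in>S. exp (m * a * h k * avg S u))"
    using S h ma
    by (intro prod_mono conjI) (auto intro!: add_nonneg_nonneg mult_nonneg_nonneg avg_nonneg simp: u_def)
  also have "\<dots> = exp (m * a * avg S u * (\<Sum>k\<in>S. h k))"
    by (simp add: exp_sum[OF fin(1), symmetric] sum_distrib_left sum_distrib_right mult_ac)
  also have "\<dots> \<le> exp (m * a * (2 / d) * (d / m))"
  proof -
    have "(\<Sum>k\<in>S. u k) \<le> (\<Sum>k<d. u k)"
      using S by (intro sum_mono2) (auto simp: u_def)
    then have "(\<Sum>k\<in>S. u k) \<le> 1" using sum_y_perm[OF \<pi>] by (simp add: u_def)
    then have "avg S u \<le> 1 / card S" unfolding avg_def by (intro divide_right_mono) auto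
    also have "\<dots> \<le> 2 / d"
      using S d_pos by (simp add: field_simps)
    finally have u: "avg S u \<le> 2 / d" .
    have "(\<Sum>k\<in>S. h k) \<le> (\<Sum>k<d. h k)"
      using S h by (intro sum_mono2) auto
    then have h': "(\<Sum>k\<in>S. h k) \<le> d / m" using h by linarith
    have "m * a * avg S u * (\<Sum>k\<in>S. h k) \<le> m * a * (2 / d) * (d / m)"
      using u h' ma S h m_pos a_ge
      by (intro mult_mono) (auto intro!: mult_nonneg_nonneg sum_nonneg avg_nonneg simp: u_def)
    then show ?thesis by simp
  qed
  also have "m * a * (2 / d) * (d / m) = 2 * a" using m_pos d_pos by simp
  finally show ?thesis by (simp add: u_def)
qed

lemma cross_term_tail:
  assumes S: "S1 \<union> S2 = {..<d}" "S1 \<inter> S2 = {}" "d \<le> 2 * card S1"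
  shows "freq (signs \<times> perms)
    (\<lambda>x. 3 * r * sqrt (N S2 (fst x) (snd x))
      < \<bar>\<Sum>j\<in>I. V S1 (fst x) (snd x) j * V S2 (fst x) (snd x) j\<bar>) \<le> 2 * exp (- a)"
proof -
  let ?P = "\<lambda>x. 3 * r * sqrt (N S2 (fst x) (snd x))
      < \<bar>\<Sum>j\<in>I. V S1 (fst x) (snd x) j * V S2 (fst x) (snd x) j\<bar>"
  let ?f = "\<lambda>\<zeta> \<xi> k. if k \<in> S1 then \<zeta> k * \<xi> k else \<xi> k :: real"
  let ?h = "\<lambda>\<omega> x. (?f (fst \<omega>) (fst x), snd x \<circ> snd \<omega>)"
  let ?Q = "{\<sigma>. \<sigma> permutes S1}"
  have S1: "S1 \<subseteq> {..<d}" "finite S1" using S finite_subset[of S1 "{..<d}"] by auto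
  have inv: "avg (signs \<times> perms) (\<lambda>x. F (?h \<omega> x)) = avg (signs \<times> perms) F"
    if \<omega>: "\<omega> \<in> signs \<times> ?Q" for \<omega> and F :: "_ \<Rightarrow> real"
  proof -
    have \<sigma>: "snd \<omega> permutes {..<d}" using \<omega> permutes_subset[OF _ S1(1)] by auto
    have "avg (signs \<times> perms) (\<lambda>x. F (?h \<omega> x))
        = avg signs (\<lambda>\<xi>. avg perms (\<lambda>\<pi>. F (?f (fst \<omega>) \<xi>, \<pi> \<circ> snd \<omega>)))"
      unfolding avg_Times fst_conv snd_conv by (rule refl)
    also have "\<dots> = avg signs (\<lambda>\<xi>. avg perms (\<lambda>\<pi>. F (?f (fst \<omega>) \<xi>, \<pi>)))"
      by (rule avg_cong) (rule avg_permutes_compose_right[OF \<sigma>])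
    also have "\<dots> = avg signs (\<lambda>\<xi>. avg perms (\<lambda>\<pi>. F (\<xi>, \<pi>)))"
      using \<omega> S1 avg_reindex_bij[OF bij_betw_sign_mult[of "fst \<omega>" d S1],
          of "\<lambda>\<xi>. avg perms (\<lambda>\<pi>. F (\<xi>, \<pi>))"] by auto
    finally show ?thesis by (simp add: avg_Times)
  qed
  \<comment> \<open>Signs and permutation are resampled on \<open>S1\<close> alone, so V S2, the
    vector held fixed, is the same for every \<omega>.\<close>
  have "freq (signs \<times> perms) ?P = avg (signs \<times> perms) (\<lambda>x. freq (signs \<times> ?Q) (\<lambda>\<omega>. ?P (?h \<omega> x)))"
    by (rule avg_invariant_resample[where F = "\<lambda>x. of_bool (?P x)" and h = ?h, OF _ _ inv])
      (use signs_finite S1 permutes_set_nonempty in \<open>auto simp: finite_permutations\<close>)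
  also have "\<dots> \<le> 2 * exp (- a)"
  proof (rule avg_le_const)
    show "finite (signs \<times> perms)" "signs \<times> perms \<noteq> {}" using signs_finite perms_finite by auto
    fix x assume x: "x \<in> signs \<times> perms"
    define \<xi> \<pi> where "\<xi> = fst x" and "\<pi> = snd x"
    have \<xi>: "\<xi> \<in> signs" and \<pi>: "\<pi> \<in> perms" using x by (auto simp: \<xi>_def \<pi>_def)
    define v where "v = V S2 \<xi> \<pi>"
    define n where "n k = (\<Sum>j\<in>I. w j k * v j)" for k
    define q where "q = sqrt (N S2 \<xi> \<pi>)"
    have NS: "N S2 \<xi> \<pi> = (\<Sum>j\<in>I. (v j)\<^sup>2)" by (simp add: N_def v_def)
    have V2: "V S2 (?f \<zeta> \<xi>) (\<pi> \<circ> \<sigma>) = v" if "\<sigma> \<in> ?Q" for \<zeta> \<sigma>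
    proof
      fix j
      have "V S2 (?f \<zeta> \<xi>) (\<pi> \<circ> \<sigma>) j = V S2 \<xi> \<pi> j"
        unfolding V_def
      proof (rule sum.cong)
        fix k assume "k \<in> S2"
        then have "k \<notin> S1" using S by auto
        then show "?f \<zeta> \<xi> k * y ((\<pi> \<circ> \<sigma>) k) * w j k = \<xi> k * y (\<pi> k) * w j k"
          using that permutes_not_in[of \<sigma> S1 k] by simp
      qed simp
      then show "V S2 (?f \<zeta> \<xi>) (\<pi> \<circ> \<sigma>) j = v j" by (simp add: v_def)
    qed
    have V1: "(\<Sum>j\<in>I. V S1 (?f \<zeta> \<xi>) (\<pi> \<circ> \<sigma>) j * v j) = (\<Sum>k\<in>S1. \<zeta> k * (\<xi> k * y (\<pi> (\<sigma> k)) * n k))" for \<zeta> \<sigma>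
      unfolding V_def n_def
      by (simp add: sum_distrib_left sum_distrib_right mult_ac sum.swap[of _ S1 I])
    have P_iff: "?P (?h \<omega> x) \<longleftrightarrow>
        3 * r * q < \<bar>\<Sum>k\<in>S1. fst \<omega> k * (\<xi> k * y (\<pi> (snd \<omega> k)) * n k)\<bar>"
      if "\<omega> \<in> signs \<times> ?Q" for \<omega>
    proof -
      have "snd \<omega> \<in> ?Q" using that by auto
      note v = V2[OF this, of "fst \<omega>"]
      have "N S2 (?f (fst \<omega>) \<xi>) (\<pi> \<circ> snd \<omega>) = N S2 \<xi> \<pi>"
        unfolding NS unfolding N_def v by (rule refl)
      then show ?thesis
        unfolding fst_conv snd_conv \<xi>_def[symmetric] \<pi>_def[symmetric] v V1 q_def by simp
    qed
    show "freq (signs \<times> ?Q) (\<lambda>\<omega>. ?P (?h \<omega> x)) \<le> 2 * exp (- a)"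
    \<comment> \<open>If the fixed vector vanishes, both sides of the event are 0, and the strict
      inequality makes it empty. Otherwise one may divide by its norm q.\<close>
    proof (cases "N S2 \<xi> \<pi> = 0")
      case True
      then have "v j = 0" if "j \<in> I" for j
        using that finite_I by (simp add: NS sum_nonneg_eq_0_iff)
      then have "n k = 0" for k by (simp add: n_def)
      then have "freq (signs \<times> ?Q) (\<lambda>\<omega>. ?P (?h \<omega> x)) \<le> freq (signs \<times> ?Q) (\<lambda>_. False)"
        using True by (intro freq_mono) (simp only: P_iff, simp add: q_def)
      also have "\<dots> = 0" by (simp add: avg_def)
      finally show ?thesis by (meson exp_ge_zero mult_nonneg_nonneg order_trans zero_le_numeral)
    next
      case False
      then have Npos: "0 < N S2 \<xi> \<pi>" by (simp add: NS sum_nonneg less_le)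
      then have q: "0 < q" "q\<^sup>2 = N S2 \<xi> \<pi>" by (auto simp: q_def)
      \<comment> \<open>\<open>h k\<close> is at most \<kappa> by Cauchy-Schwarz, and the sum of
        \<open>h\<close> is at most d/m by \<open>dual_le\<close>. The coefficients \<open>c\<close>
        are extended by 0 off \<open>S1\<close>, so that the Rademacher bound over all of
        \<open>{..<d}\<close> applies.\<close>
      define h where "h k = (n k)\<^sup>2 / N S2 \<xi> \<pi>" for k
      define c where "c \<sigma> k = (if k \<in> S1 then \<xi> k * y (\<pi> (\<sigma> k)) * n k / q else 0)" for \<sigma> k
      have sum_c: "(\<Sum>k<d. \<zeta> k * c \<sigma> k) = (\<Sum>k\<in>S1. \<zeta> k * (\<xi> k * y (\<pi> (\<sigma> k)) * n k)) / q" for \<zeta> \<sigma>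
      proof -
        have "(\<Sum>k<d. \<zeta> k * c \<sigma> k) = (\<Sum>k\<in>S1. \<zeta> k * c \<sigma> k)"
          using S1 by (intro sum.mono_neutral_right) (auto simp: c_def)
        also have "\<dots> = (\<Sum>k\<in>S1. \<zeta> k * (\<xi> k * y (\<pi> (\<sigma> k)) * n k) / q)"
          by (intro sum.cong) (auto simp: c_def)
        finally show ?thesis by (simp add: sum_divide_distrib)
      qed
      have sum_c2: "(\<Sum>k<d. (c \<sigma> k)\<^sup>2) = (\<Sum>k\<in>S1. h k * (y (\<pi> (\<sigma> k)))\<^sup>2)" for \<sigma>
      proof -
        have "(\<Sum>k<d. (c \<sigma> k)\<^sup>2) = (\<Sum>k\<in>S1. (c \<sigma> k)\<^sup>2)"
          using S1 by (intro sum.mono_neutral_right) (auto simp: c_def)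
        also have "\<dots> = (\<Sum>k\<in>S1. h k * (y (\<pi> (\<sigma> k)))\<^sup>2)"
        proof (rule sum.cong)
          fix k assume k: "k \<in> S1"
          have "(\<xi> k)\<^sup>2 = 1" using sign_vectors_square[OF \<xi>] k S1 by (auto simp: power2_eq_square)
          then show "(c \<sigma> k)\<^sup>2 = h k * (y (\<pi> (\<sigma> k)))\<^sup>2"
            using k q by (simp add: c_def h_def power_mult_distrib power_divide)
        qed simp
        finally show ?thesis .
      qed
      have h: "0 \<le> h k" "k < d \<Longrightarrow> h k \<le> \<kappa>" for k
      proof -
        show "0 \<le> h k" using Npos by (simp add: h_def)
        assume k: "k < d"
        have "(n k)\<^sup>2 \<le> (\<Sum>j\<in>I. (w j k)\<^sup>2) * N S2 \<xi> \<pi>"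
          unfolding n_def NS by (rule Cauchy_Schwarz_ineq_sum)
        also have "\<dots> \<le> \<kappa> * N S2 \<xi> \<pi>" using col_le[OF k] Npos by (intro mult_right_mono) auto
        finally show "h k \<le> \<kappa>" using Npos by (simp add: h_def divide_le_eq)
      qed
      have sum_h: "(\<Sum>k<d. h k) \<le> d / m"
        using dual_le[of v] Npos unfolding h_def n_def[symmetric] NS[symmetric]
        by (simp add: sum_divide_distrib[symmetric] divide_le_eq)
      have "freq (signs \<times> ?Q) (\<lambda>\<omega>. ?P (?h \<omega> x))
         \<le> freq (signs \<times> ?Q) (\<lambda>\<omega>. 3 * r \<le> \<bar>\<Sum>k<d. fst \<omega> k * c (snd \<omega>) k\<bar>)"
      proof (rule freq_mono)
        fix \<omega> assume "\<omega> \<in> signs \<times> ?Q" and P: "?P (?h \<omega> x)"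
        then have "3 * r * q < \<bar>\<Sum>k\<in>S1. fst \<omega> k * (\<xi> k * y (\<pi> (snd \<omega> k)) * n k)\<bar>"
          using P_iff by simp
        then show "3 * r \<le> \<bar>\<Sum>k<d. fst \<omega> k * c (snd \<omega>) k\<bar>"
          unfolding sum_c using q by (simp add: pos_le_divide_eq)
      qed
      also have "\<dots> = avg ?Q (\<lambda>\<sigma>. freq signs (\<lambda>\<zeta>. 3 * r \<le> \<bar>\<Sum>k<d. \<zeta> k * c \<sigma> k\<bar>))"
        unfolding avg_Times fst_conv snd_conv by (rule avg_swap)
      \<comment> \<open>Origin of the 3 in the threshold: at exponent \<theta> it yields exp(-3 a),
        of which the permutation average gives back at most exp(2 a).\<close>
      also have "\<dots> \<le> avg ?Q (\<lambda>\<sigma>. 2 * exp (- (3 * a)) *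
          exp (\<Sum>k\<in>S1. m * a / 2 * h k * (y (\<pi> (\<sigma> k)))\<^sup>2))"
      proof (rule avg_mono)
        fix \<sigma>
        have "freq signs (\<lambda>\<zeta>. 3 * r \<le> \<bar>\<Sum>k<d. \<zeta> k * c \<sigma> k\<bar>)
          \<le> 2 * exp (- (\<theta> * (3 * r))) * exp (\<theta>\<^sup>2 / 2 * (\<Sum>k<d. (c \<sigma> k)\<^sup>2))"
          by (rule rademacher_chernoff) (use theta_ge in auto)
        also have "\<theta> * (3 * r) = 3 * a" using theta_r by simp
        also have "\<theta>\<^sup>2 / 2 * (\<Sum>k<d. (c \<sigma> k)\<^sup>2) = (\<Sum>k\<in>S1. m * a / 2 * h k * (y (\<pi> (\<sigma> k)))\<^sup>2)"
          unfolding sum_c2 power2_eq_square[of \<theta>] theta_square by (simp add: sum_distrib_left mult_ac)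
        finally show "freq signs (\<lambda>\<zeta>. 3 * r \<le> \<bar>\<Sum>k<d. \<zeta> k * c \<sigma> k\<bar>)
          \<le> 2 * exp (- (3 * a)) * exp (\<Sum>k\<in>S1. m * a / 2 * h k * (y (\<pi> (\<sigma> k)))\<^sup>2)" .
      qed
      also have "\<dots> \<le> 2 * exp (- (3 * a)) * exp (2 * a)"
        unfolding avg_mult_left
        by (intro mult_left_mono avg_perm_exp_le \<pi> S1 S h sum_h) auto
      also have "\<dots> = 2 * exp (- a)" by (simp add: exp_add[symmetric])
      finally show ?thesis .
    qed
  qed
  finally show ?thesis .
qed


section \<open>Comparison with flipped signs, and the tail of X\<close>

text \<open>By the parallelogram law, half of X + X_\<tau> is N S + N T. This dominates the squared
  norm of either vector, so the bound has the same form whichever of S and T is resampled. The 12 is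
  4 times the 3 of \<open>cross_term_tail\<close>.\<close>

lemma decoupling_tail:
  assumes \<tau>: "\<tau> \<in> signs"
  shows "freq (signs \<times> perms)
    (\<lambda>x. 12 * r * sqrt ((X (fst x) (snd x) + X (\<lambda>k. \<tau> k * fst x k) (snd x)) / 2)
      < \<bar>X (fst x) (snd x) - X (\<lambda>k. \<tau> k * fst x k) (snd x)\<bar>) \<le> 2 * exp (- a)"
proof -
  define S T where "S = {k. k < d \<and> \<tau> k = 1}" and "T = {k. k < d \<and> \<tau> k \<noteq> 1}"
  have ST: "S \<union> T = {..<d}" "S \<inter> T = {}" "finite S" "finite T" by (auto simp: S_def T_def)
  have \<tau>T: "\<tau> k = - 1" if "k \<in> T" for k
    using that PiE_mem[OF \<tau>[unfolded sign_vectors_def], of k] by (auto simp: T_def)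
  let ?ip = "\<lambda>x. \<Sum>j\<in>I. V S (fst x) (snd x) j * V T (fst x) (snd x) j"
  have V1: "V {..<d} \<xi> \<pi> j = V S \<xi> \<pi> j + V T \<xi> \<pi> j" for \<xi> \<pi> j
    unfolding V_def ST(1)[symmetric] using ST by (intro sum.union_disjoint) auto
  have V2: "V {..<d} (\<lambda>k. \<tau> k * \<xi> k) \<pi> j = V S \<xi> \<pi> j - V T \<xi> \<pi> j" for \<xi> \<pi> j
    unfolding V1 unfolding V_def using \<tau>T by (simp add: S_def sum_negf[symmetric])
  have diff: "X \<xi> \<pi> - X (\<lambda>k. \<tau> k * \<xi> k) \<pi> = 4 * (\<Sum>j\<in>I. V S \<xi> \<pi> j * V T \<xi> \<pi> j)" for \<xi> \<pi>
    unfolding X_def N_def V2 unfolding V1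
    by (simp add: sum_subtractf[symmetric] sum_distrib_left power2_eq_square algebra_simps)
  have add: "(X \<xi> \<pi> + X (\<lambda>k. \<tau> k * \<xi> k) \<pi>) / 2 = N S \<xi> \<pi> + N T \<xi> \<pi>" for \<xi> \<pi>
    unfolding X_def N_def V2 unfolding V1
    by (simp add: sum.distrib[symmetric] sum_divide_distrib power2_eq_square algebra_simps
        add_divide_distrib)
  have N_nonneg: "0 \<le> N U \<xi> \<pi>" for U \<xi> \<pi> unfolding N_def by (intro sum_nonneg) auto
  let ?B = "\<lambda>x. 12 * r * sqrt (N S (fst x) (snd x) + N T (fst x) (snd x)) < \<bar>4 * ?ip x\<bar>"
  have le: "3 * r * sqrt (N U (fst x) (snd x)) < \<bar>?ip x\<bar>" if "?B x" "U = S \<or> U = T" for x U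
  proof -
    have "r * sqrt (N U (fst x) (snd x)) \<le> r * sqrt (N S (fst x) (snd x) + N T (fst x) (snd x))"
      using N_nonneg that r_nonneg by (intro mult_left_mono real_sqrt_le_mono) auto
    moreover have "\<bar>4 * ?ip x\<bar> = 4 * \<bar>?ip x\<bar>" by simp
    ultimately show ?thesis using that(1) by linarith
  qed
  have "card S + card T = d"
    using card_Un_disjoint[OF ST(3,4,2)] ST(1) by simp
  then consider "d \<le> 2 * card S" | "d \<le> 2 * card T" by linarith
  then have "freq (signs \<times> perms) ?B \<le> 2 * exp (- a)"
  proof cases
    case 1
    have "freq (signs \<times> perms) ?B \<le> freq (signs \<times> perms) (\<lambda>x. 3 * r * sqrt (N T (fst x) (snd x)) < \<bar>?ip x\<bar>)"
      using le by (intro freq_mono) auto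
    also have "\<dots> \<le> 2 * exp (- a)" by (rule cross_term_tail[OF ST(1,2) 1])
    finally show ?thesis .
  next
    case 2
    have "freq (signs \<times> perms) ?B \<le> freq (signs \<times> perms) (\<lambda>x. 3 * r * sqrt (N S (fst x) (snd x))
        < \<bar>\<Sum>j\<in>I. V T (fst x) (snd x) j * V S (fst x) (snd x) j\<bar>)"
      using le unfolding mult.commute[of "V T _ _ _"] by (intro freq_mono) auto
    also have "\<dots> \<le> 2 * exp (- a)"
      by (rule cross_term_tail) (use ST 2 in auto)
    finally show ?thesis .
  qed
  then show ?thesis unfolding diff add .
qed

lemma avg_X_signs:
  assumes "\<xi> \<in> signs"
  shows "avg signs (\<lambda>\<tau>. X (\<lambda>k. \<tau> k * \<xi> k) \<pi>) = tr \<pi>"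
proof -
  have "avg signs (\<lambda>\<tau>. X (\<lambda>k. \<tau> k * \<xi> k) \<pi>)
      = (\<Sum>j\<in>I. avg signs (\<lambda>\<tau>. (\<Sum>k<d. \<tau> k * (\<xi> k * y (\<pi> k) * w j k))\<^sup>2))"
    unfolding X_def N_def V_def by (simp add: avg_sum mult.assoc)
  also have "\<dots> = (\<Sum>j\<in>I. \<Sum>k<d. (w j k)\<^sup>2 * (y (\<pi> k))\<^sup>2)"
  proof (unfold rademacher_second_moment, intro sum.cong refl)
    fix j k assume "k \<in> {..<d}"
    then have "(\<xi> k)\<^sup>2 = 1" using sign_vectors_square[OF assms] by (simp add: power2_eq_square)
    then show "(\<xi> k * y (\<pi> k) * w j k)\<^sup>2 = (w j k)\<^sup>2 * (y (\<pi> k))\<^sup>2"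
      by (simp add: power_mult_distrib)
  qed
  also have "\<dots> = tr \<pi>"
    unfolding tr_def g_def by (subst sum.swap) (simp add: sum_distrib_right)
  finally show ?thesis .
qed

text \<open>The Hilbert-Schmidt bound \<open>d\<close> is crude, but it is paid only on exceptional
  \<tau>, a proportion of at most 1/d^2.\<close>

lemma X_bounds:
  assumes "\<xi> \<in> signs" "\<pi> \<in> perms"
  shows "0 \<le> X \<xi> \<pi>" "X \<xi> \<pi> \<le> d"
proof -
  show "0 \<le> X \<xi> \<pi>" unfolding X_def N_def by (intro sum_nonneg) auto
  have "(\<Sum>k<d. (\<xi> k * y (\<pi> k))\<^sup>2) = (\<Sum>k<d. (y (\<pi> k))\<^sup>2)"
    using sign_vectors_square[OF assms(1)] by (intro sum.cong) (auto simp: power2_eq_square)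
  then have 1: "(\<Sum>k<d. (\<xi> k * y (\<pi> k))\<^sup>2) = 1" using sum_y_perm[OF assms(2)] by simp
  have "X \<xi> \<pi> \<le> (\<Sum>j\<in>I. (\<Sum>k<d. (\<xi> k * y (\<pi> k))\<^sup>2) * (\<Sum>k<d. (w j k)\<^sup>2))"
    unfolding X_def N_def V_def by (intro sum_mono Cauchy_Schwarz_ineq_sum)
  also have "\<dots> = d" using 1 col_sum by (simp add: sum.swap[of _ I])
  finally show "X \<xi> \<pi> \<le> d" .
qed

text \<open>A pointwise product of sign vectors need not be \<open>undefined\<close> outside
  \<open>{..<d}\<close>, so it is replaced by an element of \<open>signs\<close> that agrees with it
  on the coordinates X reads.\<close>

lemma sign_mult_closed:
  assumes "\<tau> \<in> signs" "\<xi> \<in> signs"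
  shows "\<exists>\<xi>'\<in>signs. X (\<lambda>k. \<tau> k * \<xi> k) \<pi> = X \<xi>' \<pi>"
proof
  show "(\<lambda>k. if k \<in> {..<d} then \<tau> k * \<xi> k else \<xi> k) \<in> signs"
    using bij_betwE[OF bij_betw_sign_mult[OF assms(1), of "{..<d}"]] assms(2) by simp
  show "X (\<lambda>k. \<tau> k * \<xi> k) \<pi> = X (\<lambda>k. if k \<in> {..<d} then \<tau> k * \<xi> k else \<xi> k) \<pi>"
    unfolding X_def N_def V_def by (intro sum.cong refl arg_cong[where f = "\<lambda>t. t\<^sup>2"]) auto
qed

text \<open>Averaging over \<open>\<tau>\<close> turns the bound on \<open>X - X \<tau>\<close> by the square root of \<open>X + X \<tau>\<close> into a
  bound on \<open>X - tr\<close> that involves \<open>X\<close> itself, and is solved for \<open>X\<close>. The few \<open>\<tau>\<close> for which it fails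
  contribute at most \<open>d\<close> times their proportion.\<close>

lemma X_deviation:
  assumes \<xi>: "\<xi> \<in> signs" and \<pi>: "\<pi> \<in> perms"
    and bad: "freq signs (\<lambda>\<tau>. 12 * r * sqrt ((X \<xi> \<pi> + X (\<lambda>k. \<tau> k * \<xi> k) \<pi>) / 2)
      < \<bar>X \<xi> \<pi> - X (\<lambda>k. \<tau> k * \<xi> k) \<pi>\<bar>) \<le> 1 / (real d)\<^sup>2" (is "freq signs ?B \<le> _")
    and tr: "\<bar>tr \<pi> - 1\<bar> \<le> 2 * r"
  shows "\<bar>X \<xi> \<pi> - 1\<bar> \<le> 45 / 2 * r"
proof -
  let ?X = "X \<xi> \<pi>" and ?Y = "\<lambda>\<tau>. X (\<lambda>k. \<tau> k * \<xi> k) \<pi>"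
  have Y: "0 \<le> ?Y \<tau>" "?Y \<tau> \<le> d" if "\<tau> \<in> signs" for \<tau>
    using sign_mult_closed[OF that \<xi>, of \<pi>] X_bounds \<pi> by auto
  note X = X_bounds[OF \<xi> \<pi>]
  have "\<bar>?X - tr \<pi>\<bar> = \<bar>avg signs (\<lambda>\<tau>. ?X - ?Y \<tau>)\<bar>"
    using signs_finite avg_X_signs[OF \<xi>] by (simp add: avg_diff avg_const)
  also have "\<dots> \<le> avg signs (\<lambda>\<tau>. \<bar>?X - ?Y \<tau>\<bar>)" by (rule abs_avg_le)
  also have "\<dots> \<le> avg signs (\<lambda>\<tau>. (6 * r + 3 * r * ?X) + 3 * r * ?Y \<tau> + d * of_bool (?B \<tau>))"
  proof (rule avg_mono)
    fix \<tau> assume \<tau>: "\<tau> \<in> signs"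
    have 0: "0 \<le> (6 * r + 3 * r * ?X) + 3 * r * ?Y \<tau>"
      using r_nonneg X Y[OF \<tau>] by (intro add_nonneg_nonneg mult_nonneg_nonneg) auto
    show "\<bar>?X - ?Y \<tau>\<bar> \<le> (6 * r + 3 * r * ?X) + 3 * r * ?Y \<tau> + d * of_bool (?B \<tau>)"
    proof (cases "?B \<tau>")
      case True
      then show ?thesis using 0 X Y[OF \<tau>] by (simp add: abs_le_iff)
    next
      case False
      \<comment> \<open>The arithmetic-geometric mean inequality makes the bound linear in X_\<tau>,
        whose average over \<tau> is exactly \<open>tr \<pi>\<close>.\<close>
      have "sqrt ((?X + ?Y \<tau>) / 2) \<le> (1 + (?X + ?Y \<tau>) / 2) / 2"
        using arith_geo_mean_sqrt[of 1 "(?X + ?Y \<tau>) / 2"] X Y[OF \<tau>] by simp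
      then have "12 * r * sqrt ((?X + ?Y \<tau>) / 2) \<le> 12 * r * ((1 + (?X + ?Y \<tau>) / 2) / 2)"
        using r_nonneg by (intro mult_left_mono) auto
      also have "\<dots> = (6 * r + 3 * r * ?X) + 3 * r * ?Y \<tau>" by (simp add: algebra_simps)
      finally show ?thesis using False by simp
    qed
  qed
  also have "\<dots> = (6 * r + 3 * r * ?X) + 3 * r * tr \<pi> + d * freq signs ?B"
    unfolding avg_add avg_mult_left avg_X_signs[OF \<xi>]
    using signs_finite avg_mult_left[of signs "real d" "\<lambda>\<tau>. of_bool (?B \<tau>)"] by (simp add: avg_const)
  also have "d * freq signs ?B \<le> d * (1 / (real d)\<^sup>2)"
    using bad by (intro mult_left_mono) auto
  also have "\<dots> \<le> r" using r_ge d_pos by (simp add: power2_eq_square)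
  finally have dev: "\<bar>?X - tr \<pi>\<bar> \<le> 7 * r + 3 * r * ?X + 3 * r * tr \<pi>" by simp
  \<comment> \<open>With r <= 1/45 the coefficient 3 r of |\<Delta>| is at most 1/15 and is absorbed
    on the left. The remaining multiples of r are 7 + 6 + 2 = 15 and 2/15, so |\<Delta>| <= (227/14)
    r, which is below 45/2 r.\<close>
  define \<Delta> where "\<Delta> = ?X - 1"
  have r3: "3 * r * \<bar>\<Delta>\<bar> \<le> \<bar>\<Delta>\<bar> / 15" "3 * r * (tr \<pi> - 1) \<le> (2 * r) / 15"
  proof -
    show "3 * r * \<bar>\<Delta>\<bar> \<le> \<bar>\<Delta>\<bar> / 15" using mult_right_mono[OF r_le, of "\<bar>\<Delta>\<bar>"] by simp
    have "3 * r * (tr \<pi> - 1) \<le> 3 * r * (2 * r)" using tr r_nonneg by (intro mult_left_mono) auto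
    also have "\<dots> \<le> (2 * r) / 15" using mult_right_mono[OF r_le, of "6 * r"] r_nonneg by simp
    finally show "3 * r * (tr \<pi> - 1) \<le> (2 * r) / 15" .
  qed
  have "3 * r * ?X + 3 * r * tr \<pi> = 6 * r + 3 * r * \<Delta> + 3 * r * (tr \<pi> - 1)"
    by (simp add: \<Delta>_def algebra_simps)
  moreover have "3 * r * \<Delta> \<le> 3 * r * \<bar>\<Delta>\<bar>" using r_nonneg by (intro mult_left_mono) auto
  ultimately have "\<bar>\<Delta>\<bar> \<le> 15 * r + \<bar>\<Delta>\<bar> / 15 + 2 * r / 15"
    using dev tr r3 unfolding \<Delta>_def by linarith
  moreover have "t \<le> 45 / 2 * r" if "t \<le> 15 * r + t / 15 + 2 * r / 15" for t
    using that r_nonneg by linarith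
  ultimately show ?thesis unfolding \<Delta>_def by blast
qed

text \<open>\<open>decoupling_tail\<close> holds for each fixed \<tau>, while
  \<open>X_deviation\<close> needs few bad \<tau> for a fixed outcome. Exchanging the averages and
  applying Markov's inequality at level 1/d^2 gives 2 d^2 exp(-a); the two diagonal tails add at
  most the same again.\<close>

lemma chaos_tail:
  "freq (signs \<times> perms) (\<lambda>x. 45 / 2 * r < \<bar>X (fst x) (snd x) - 1\<bar>) \<le> 4 * (real d)\<^sup>2 * exp (- a)"
proof -
  let ?A = "signs \<times> perms"
  let ?B = "\<lambda>x \<tau>. 12 * r * sqrt ((X (fst x) (snd x) + X (\<lambda>k. \<tau> k * fst x k) (snd x)) / 2)
      < \<bar>X (fst x) (snd x) - X (\<lambda>k. \<tau> k * fst x k) (snd x)\<bar>"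
  let ?\<beta> = "\<lambda>x. freq signs (?B x)"
  have "freq ?A (\<lambda>x. 45 / 2 * r < \<bar>X (fst x) (snd x) - 1\<bar>)
     \<le> freq ?A (\<lambda>x. 1 / (real d)\<^sup>2 \<le> ?\<beta> x \<or> (1 + 2 * r \<le> tr (snd x) \<or> tr (snd x) \<le> 1 - 2 * r))"
  proof (rule freq_mono)
    fix x assume x: "x \<in> ?A" "45 / 2 * r < \<bar>X (fst x) (snd x) - 1\<bar>"
    show "1 / (real d)\<^sup>2 \<le> ?\<beta> x \<or> (1 + 2 * r \<le> tr (snd x) \<or> tr (snd x) \<le> 1 - 2 * r)"
    proof (rule ccontr)
      assume "\<not> ?thesis"
      then have "\<bar>X (fst x) (snd x) - 1\<bar> \<le> 45 / 2 * r"
        using x by (intro X_deviation) auto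
      then show False using x by simp
    qed
  qed
  also have "\<dots> \<le> freq ?A (\<lambda>x. 1 / (real d)\<^sup>2 \<le> ?\<beta> x)
      + (freq ?A (\<lambda>x. 1 + 2 * r \<le> tr (snd x)) + freq ?A (\<lambda>x. tr (snd x) \<le> 1 - 2 * r))"
    by (intro order_trans[OF freq_disj_le] add_left_mono freq_disj_le)
  finally have union: "freq ?A (\<lambda>x. 45 / 2 * r < \<bar>X (fst x) (snd x) - 1\<bar>)
    \<le> freq ?A (\<lambda>x. 1 / (real d)\<^sup>2 \<le> ?\<beta> x)
      + (freq ?A (\<lambda>x. 1 + 2 * r \<le> tr (snd x)) + freq ?A (\<lambda>x. tr (snd x) \<le> 1 - 2 * r))" .
  have "freq ?A (\<lambda>x. 1 / (real d)\<^sup>2 \<le> ?\<beta> x) \<le> avg ?A ?\<beta> / (1 / (real d)\<^sup>2)"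
    using d_pos by (intro freq_markov avg_nonneg) auto
  also have "avg ?A ?\<beta> = avg signs (\<lambda>\<tau>. freq ?A (\<lambda>x. ?B x \<tau>))" by (rule avg_swap)
  also have "\<dots> / (1 / (real d)\<^sup>2) \<le> (2 * exp (- a)) / (1 / (real d)\<^sup>2)"
    using signs_finite by (intro divide_right_mono avg_le_const decoupling_tail) auto
  finally have "freq ?A (\<lambda>x. 1 / (real d)\<^sup>2 \<le> ?\<beta> x) \<le> 2 * (real d)\<^sup>2 * exp (- a)"
    by (simp add: mult_ac)
  moreover have "freq ?A (\<lambda>x. 1 + 2 * r \<le> tr (snd x)) \<le> exp (- a)"
    unfolding avg_Times snd_conv using signs_finite trace_upper by (simp add: avg_const)
  moreover have "freq ?A (\<lambda>x. tr (snd x) \<le> 1 - 2 * r) \<le> exp (- a)"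
    unfolding avg_Times snd_conv using signs_finite trace_lower by (simp add: avg_const)
  moreover have "1 * exp (- a) \<le> (real d)\<^sup>2 * exp (- a)"
    using d_pos by (intro mult_right_mono) auto
  ultimately show ?thesis using union by linarith
qed

end

section \<open>A net of sparse grid vectors\<close>

definition grid :: "nat \<Rightarrow> nat \<Rightarrow> (nat \<Rightarrow> int) set" where
  "grid d s = {n \<in> {..<d} \<rightarrow>\<^sub>E {- 5 * int s..5 * int s}.
     card {i. i < d \<and> n i \<noteq> 0} \<le> s \<and> (\<Sum>i<d. (n i)\<^sup>2) \<le> 25 * int s}"

text \<open>With mesh 1/(5 sqrt s), rounding s coordinates moves a vector by squared distance at
  most 1/25, and the bound 25 s in \<open>grid\<close> is the unit ball at this scale.\<close>

definition grid_point :: "nat \<Rightarrow> (nat \<Rightarrow> int) \<Rightarrow> nat \<Rightarrow> real" where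
  "grid_point s n i = of_int (n i) / (5 * sqrt (real s))"

lemma finite_grid: "finite (grid d s)"
  unfolding grid_def by (rule finite_subset[of _ "{..<d} \<rightarrow>\<^sub>E {- 5 * int s..5 * int s}"])
    (auto intro: finite_PiE)

text \<open>Keeping the geometric remainder (1/2)^R makes the induction close.\<close>

lemma sum_weights_le:
  assumes "0 \<le> (t::real)"
  shows "(\<Sum>n\<in>{- int R..int R}. (if n = 0 then 1 else t) * (1 / 2) ^ nat \<bar>n\<bar>) \<le> 1 + 2 * t * (1 - (1 / 2) ^ R)"
proof (induction R)
  case (Suc R)
  let ?f = "\<lambda>n::int. (if n = 0 then 1 else t) * (1 / 2 :: real) ^ nat \<bar>n\<bar>"
  have "{- int (Suc R)..int (Suc R)} = insert (int (Suc R)) (insert (- int (Suc R)) {- int R..int R})"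
    by auto
  then have "(\<Sum>n\<in>{- int (Suc R)..int (Suc R)}. ?f n)
      = ?f (int (Suc R)) + (?f (- int (Suc R)) + (\<Sum>n\<in>{- int R..int R}. ?f n))"
    by simp
  also have "?f (int (Suc R)) = t * (1 / 2) ^ Suc R" by (simp add: nat_add_distrib)
  also have "?f (- int (Suc R)) = t * (1 / 2) ^ Suc R" by (simp add: nat_add_distrib)
  also have "t * (1 / 2) ^ Suc R + (t * (1 / 2) ^ Suc R + (\<Sum>n\<in>{- int R..int R}. ?f n))
      \<le> t * (1 / 2) ^ Suc R + (t * (1 / 2) ^ Suc R + (1 + 2 * t * (1 - (1 / 2) ^ R)))"
    using Suc.IH by simp
  also have "\<dots> = 1 + 2 * t * (1 - (1 / 2) ^ Suc R)" by (simp add: algebra_simps)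
  finally show ?case .
qed simp

text \<open>Give \<open>n\<close> the weight \<open>t ^ l * 2 ^ - (\<Sum>i<d. \<bar>n i\<bar>)\<close> with \<open>t = s / d\<close>, where \<open>l\<close> is the number of
  nonzero entries: grid vectors have weight at least \<open>t ^ s * 2 ^ - (25 * s)\<close>, and the weights of
  all integer vectors sum to at most \<open>(1 + 2 * t) ^ d\<close>.\<close>

lemma card_grid_le:
  assumes "1 \<le> s" "s \<le> d"
  shows "real (card (grid d s)) \<le> exp (27 * (real s * ln (exp 1 * real d / real s)))"
proof -
  define t where "t = real s / real d"
  define f where "f n = (if n = 0 then 1 else t) * (1 / 2) ^ nat \<bar>n\<bar>" for n :: int
  have t: "0 < t" "t \<le> 1" using assms by (auto simp: t_def)
  have f_nonneg: "0 \<le> f n" for n using t by (auto simp: f_def)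
  define K where "K = (1 / 2) ^ (25 * s) * t ^ s"
  have K: "0 < K" using t by (simp add: K_def)
  let ?G = "{..<d} \<rightarrow>\<^sub>E {- 5 * int s..5 * int s}"
  have "real (card (grid d s)) * K = (\<Sum>n\<in>grid d s. K)" by simp
  also have "\<dots> \<le> (\<Sum>n\<in>grid d s. \<Prod>i<d. f (n i))"
  proof (rule sum_mono)
    fix n assume n: "n \<in> grid d s"
    let ?Z = "{i. i < d \<and> n i \<noteq> 0}"
    have "(\<Sum>i<d. nat \<bar>n i\<bar>) \<le> 25 * s"
    proof -
      have "\<bar>k\<bar> \<le> k\<^sup>2" for k :: int
      proof (cases "k = 0")
        case False
        then have "\<bar>k\<bar> * 1 \<le> \<bar>k\<bar> * \<bar>k\<bar>" by (intro mult_left_mono) auto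
        then show ?thesis by (simp add: power2_eq_square)
      qed simp
      then have "(\<Sum>i<d. \<bar>n i\<bar>) \<le> (\<Sum>i<d. (n i)\<^sup>2)" by (intro sum_mono)
      also have "\<dots> \<le> 25 * int s" using n by (simp add: grid_def)
      finally have "int (\<Sum>i<d. nat \<bar>n i\<bar>) \<le> int (25 * s)" by simp
      then show ?thesis by (simp only: of_nat_le_iff)
    qed
    then have 1: "(1 / 2 :: real) ^ (25 * s) \<le> (1 / 2) ^ (\<Sum>i<d. nat \<bar>n i\<bar>)"
      by (intro power_decreasing) auto
    have 2: "t ^ s \<le> t ^ card ?Z" using n t by (intro power_decreasing) (auto simp: grid_def)
    have "(\<Prod>i<d. if n i = 0 then 1 else t) = (\<Prod>i\<in>?Z. t)"
      by (intro prod.mono_neutral_cong_right) auto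
    then have "(\<Prod>i<d. f (n i)) = t ^ card ?Z * (1 / 2) ^ (\<Sum>i<d. nat \<bar>n i\<bar>)"
      unfolding f_def by (simp add: prod.distrib power_sum)
    then show "K \<le> (\<Prod>i<d. f (n i))"
      unfolding K_def using mult_mono[OF 2 1] t by (simp add: mult.commute)
  qed
  also have "\<dots> \<le> (\<Sum>n\<in>?G. \<Prod>i<d. f (n i))"
    using f_nonneg by (intro sum_mono2) (auto simp: grid_def intro: finite_PiE prod_nonneg)
  also have "\<dots> = (\<Prod>i<d. \<Sum>k\<in>{- 5 * int s..5 * int s}. f k)"
    by (rule prod_sum_PiE[symmetric]) auto
  also have "\<dots> \<le> (\<Prod>i<d. exp (2 * t))"
  proof (intro prod_mono conjI)
    show "0 \<le> (\<Sum>k\<in>{- 5 * int s..5 * int s}. f k)" using f_nonneg by (intro sum_nonneg)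
    have "(\<Sum>k\<in>{- 5 * int s..5 * int s}. f k) \<le> 1 + 2 * t * (1 - (1 / 2) ^ (5 * s))"
      using sum_weights_le[of t "5 * s"] t unfolding f_def by simp
    also have "\<dots> \<le> 1 + 2 * t" using t by (simp add: mult_le_cancel_left1)
    also have "\<dots> \<le> exp (2 * t)" by simp
    finally show "(\<Sum>k\<in>{- 5 * int s..5 * int s}. f k) \<le> exp (2 * t)" .
  qed
  also have "\<dots> = exp (2 * real s)"
    using assms by (simp add: t_def exp_of_nat_mult[symmetric])
  finally have "real (card (grid d s)) \<le> exp (2 * real s) / K" using K by (simp add: pos_le_divide_eq)
  also have "\<dots> = exp (2 * real s) * 2 ^ (25 * s) * (real d / real s) ^ s"
    by (simp add: K_def t_def power_divide)
  \<comment> \<open>Replacing 2 by e puts everything into one exponent; 27 = 2 + 25.\<close>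
  also have "\<dots> \<le> exp (2 * real s) * exp (25 * real s) * (real d / real s) ^ s"
  proof -
    have "(2::real) ^ (25 * s) \<le> exp 1 ^ (25 * s)"
      using exp_ge_add_one_self[of 1] by (intro power_mono) auto
    also have "\<dots> = exp (25 * real s)" by (simp add: exp_of_nat_mult[symmetric])
    finally show ?thesis by (intro mult_right_mono mult_left_mono) auto
  qed
  also have "(real d / real s) ^ s = exp (real s * ln (real d / real s))"
    using assms by (simp add: exp_of_nat_mult)
  also have "exp (2 * real s) * exp (25 * real s) * exp (real s * ln (real d / real s))
      = exp (27 * real s + real s * ln (real d / real s))"
    by (simp add: exp_add[symmetric])
  also have "\<dots> \<le> exp (27 * (real s * ln (exp 1 * real d / real s)))"
  proof -
    have "ln (exp 1 * real d / real s) = 1 + ln (real d / real s)"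
      using assms ln_mult[of "exp 1" "real d / real s"] by simp
    moreover have "0 \<le> real s * ln (real d / real s)" using assms by simp
    ultimately show ?thesis by (simp add: algebra_simps)
  qed
  finally show ?thesis .
qed

text \<open>Rounding is towards zero, so that the net point has no larger norm and its support lies
  inside that of the original vector.\<close>

lemma ex_int_truncation: "\<exists>n::int. \<bar>of_int n\<bar> \<le> \<bar>t\<bar> \<and> \<bar>t - of_int n\<bar> \<le> 1" for t :: real
proof (cases "0 \<le> t")
  case True
  then have "0 \<le> \<lfloor>t\<rfloor>" by simp
  then have "0 \<le> real_of_int \<lfloor>t\<rfloor>" by (simp only: of_int_0_le_iff)
  then show ?thesis
    using floor_correct[of t] by (intro exI[of _ "\<lfloor>t\<rfloor>"]) linarith
next
  case False
  then have "\<lceil>t\<rceil> \<le> 0" by simp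
  then have "real_of_int \<lceil>t\<rceil> \<le> 0" by (simp only: of_int_le_0_iff)
  then show ?thesis
    using False ceiling_correct[of t] by (intro exI[of _ "\<lceil>t\<rceil>"]) linarith
qed

lemma ex_grid_point_near:
  fixes x :: "nat \<Rightarrow> real"
  assumes s: "1 \<le> s" and x: "(\<Sum>i<d. (x i)\<^sup>2) \<le> 1" "card {i. i < d \<and> x i \<noteq> 0} \<le> s"
  obtains n where "n \<in> grid d s" "\<And>i. i < d \<Longrightarrow> x i = 0 \<Longrightarrow> grid_point s n i = 0"
    "(\<Sum>i<d. (x i - grid_point s n i)\<^sup>2) \<le> 1 / 25" "(\<Sum>i<d. (grid_point s n i)\<^sup>2) \<le> 1"
proof -
  define u where "u = 5 * sqrt (real s)"
  have u: "0 < u" "u\<^sup>2 = 25 * real s" using s by (auto simp: u_def power_mult_distrib)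
  have "\<exists>f :: nat \<Rightarrow> int. \<forall>i. \<bar>of_int (f i)\<bar> \<le> \<bar>u * x i\<bar> \<and> \<bar>u * x i - of_int (f i)\<bar> \<le> 1"
    by (rule choice) (use ex_int_truncation in blast)
  then obtain f :: "nat \<Rightarrow> int" where f: "\<bar>of_int (f i)\<bar> \<le> \<bar>u * x i\<bar>" "\<bar>u * x i - of_int (f i)\<bar> \<le> 1" for i
    by blast
  define n where "n i = (if i < d then f i else undefined)" for i
  have n: "\<bar>of_int (n i)\<bar> \<le> \<bar>u * x i\<bar>" "\<bar>u * x i - of_int (n i)\<bar> \<le> 1" if "i < d" for i
    using f[of i] that by (auto simp: n_def)
  have n0: "n i = 0" if "i < d" "x i = 0" for i using n(1)[OF that(1)] that by simp
  have n2: "(of_int (n i))\<^sup>2 \<le> 25 * real s * (x i)\<^sup>2" if "i < d" for i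
    using abs_le_square_iff[THEN iffD1, OF n(1)[OF that]] by (simp add: power_mult_distrib u)
  have "(\<Sum>i<d. (of_int (n i) :: real)\<^sup>2) \<le> (\<Sum>i<d. 25 * real s * (x i)\<^sup>2)"
    using n2 by (intro sum_mono) auto
  also have "\<dots> \<le> 25 * real s" using x(1) s by (simp add: sum_distrib_left[symmetric] mult_left_le)
  finally have sum_n: "(\<Sum>i<d. (of_int (n i) :: real)\<^sup>2) \<le> 25 * real s" .
  then have "of_int (\<Sum>i<d. (n i)\<^sup>2) \<le> (of_int (25 * int s) :: real)" by simp
  then have sum_n': "(\<Sum>i<d. (n i)\<^sup>2) \<le> 25 * int s" by (simp only: of_int_le_iff)
  have range: "n i \<in> {- 5 * int s..5 * int s}" if "i < d" for i
  proof -
    have "(n i)\<^sup>2 \<le> (\<Sum>i<d. (n i)\<^sup>2)" using that by (intro member_le_sum) auto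
    also have "\<dots> \<le> 25 * (int s * int s)" using sum_n' s by (simp add: order_trans)
    also have "\<dots> = (5 * int s)\<^sup>2" by (simp add: power2_eq_square)
    finally have "\<bar>n i\<bar> \<le> 5 * int s" using abs_le_square_iff[of "n i" "5 * int s"] by simp
    then show ?thesis by auto
  qed
  show ?thesis
  proof (rule that)
    have "card {i. i < d \<and> n i \<noteq> 0} \<le> card {i. i < d \<and> x i \<noteq> 0}"
      using n0 by (intro card_mono) auto
    then show "n \<in> grid d s"
      unfolding grid_def using range sum_n' x(2) by (auto simp: PiE_iff extensional_def n_def)
    show "grid_point s n i = 0" if "i < d" "x i = 0" for i
      using n0[OF that] by (simp add: grid_point_def)
    have "(\<Sum>i<d. (x i - grid_point s n i)\<^sup>2) \<le> (\<Sum>i\<in>{i. i < d \<and> x i \<noteq> 0}. 1 / u\<^sup>2)"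
    proof -
      have "(\<Sum>i<d. (x i - grid_point s n i)\<^sup>2) = (\<Sum>i\<in>{i. i < d \<and> x i \<noteq> 0}. (x i - grid_point s n i)\<^sup>2)"
        using n0 by (intro sum.mono_neutral_right) (auto simp: grid_point_def)
      also have "\<dots> \<le> (\<Sum>i\<in>{i. i < d \<and> x i \<noteq> 0}. 1 / u\<^sup>2)"
      proof (rule sum_mono)
        fix i assume "i \<in> {i. i < d \<and> x i \<noteq> 0}"
        then have "i < d" by simp
        have "(x i - grid_point s n i)\<^sup>2 = (u * x i - of_int (n i))\<^sup>2 / u\<^sup>2"
          using u(1) by (simp add: grid_point_def u_def[symmetric] power_divide[symmetric] diff_divide_distrib)
        also have "\<dots> \<le> 1 / u\<^sup>2"
          using n(2)[OF \<open>i < d\<close>] by (intro divide_right_mono) (auto simp: abs_square_le_1)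
        finally show "(x i - grid_point s n i)\<^sup>2 \<le> 1 / u\<^sup>2" .
      qed
      finally show ?thesis .
    qed
    also have "\<dots> = card {i. i < d \<and> x i \<noteq> 0} / (25 * real s)" using u by simp
    also have "\<dots> \<le> real s / (25 * real s)" using x(2) by (intro divide_right_mono) auto
    also have "\<dots> = 1 / 25" using s by simp
    finally show "(\<Sum>i<d. (x i - grid_point s n i)\<^sup>2) \<le> 1 / 25" .
    have "(\<Sum>i<d. (grid_point s n i)\<^sup>2) = (\<Sum>i<d. (of_int (n i) :: real)\<^sup>2) / (25 * real s)"
      using u by (simp add: grid_point_def u_def[symmetric] power_divide sum_divide_distrib)
    also have "\<dots> \<le> 1" using sum_n s by simp
    finally show "(\<Sum>i<d. (grid_point s n i)\<^sup>2) \<le> 1" .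
  qed
qed

section \<open>From the net to all sparse vectors\<close>

text \<open>The quadratic form of \<Phi>^T \<Phi> - 1. Being homogeneous and taken on plain
  functions, it can be evaluated at grid points and at combinations of vectors without normalising
  them.\<close>

definition isometry_defect :: "real mat \<Rightarrow> (nat \<Rightarrow> real) \<Rightarrow> real" where
  "isometry_defect \<Phi> x =
     (\<Sum>i<dim_row \<Phi>. (\<Sum>k<dim_col \<Phi>. \<Phi> $$ (i, k) * x k)\<^sup>2) - (\<Sum>k<dim_col \<Phi>. (x k)\<^sup>2)"

lemma vec_l2_norm_square: "(vec_l2_norm v)\<^sup>2 = (\<Sum>i<dim_vec v. (v $ i)\<^sup>2)"
  unfolding vec_l2_norm_def L2_set_def by (simp add: sum_nonneg)

lemma mult_mat_vec_square:
  assumes "x \<in> carrier_vec (dim_col \<Phi>)"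
  shows "(vec_l2_norm (\<Phi> *\<^sub>v x))\<^sup>2 = (\<Sum>i<dim_row \<Phi>. (\<Sum>k<dim_col \<Phi>. \<Phi> $$ (i, k) * x $ k)\<^sup>2)"
  unfolding vec_l2_norm_square using assms
  by (intro sum.cong arg_cong[where f = "\<lambda>t. t\<^sup>2"]) (auto simp: scalar_prod_def atLeast0LessThan)

lemma isometry_defect_scale: "isometry_defect \<Phi> (\<lambda>k. c * x k) = c\<^sup>2 * isometry_defect \<Phi> x"
  unfolding isometry_defect_def
  by (simp add: mult.left_commute[of _ c] sum_distrib_left[symmetric] power_mult_distrib right_diff_distrib)

text \<open>Polarization in the form that needs no bilinear form: the two vectors on the left are
  \<open>3 * (x - y) + (x + y) / 3\<close> and \<open>3 * (x - y) - (x + y) / 3\<close>.\<close>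

lemma isometry_defect_diff:
  "isometry_defect \<Phi> (\<lambda>k. 10 / 3 * x k - 8 / 3 * y k) - isometry_defect \<Phi> (\<lambda>k. 8 / 3 * x k - 10 / 3 * y k)
    = 4 * (isometry_defect \<Phi> x - isometry_defect \<Phi> y)"
proof -
  have sq: "(10 / 3 * p - 8 / 3 * q)\<^sup>2 - (8 / 3 * p - 10 / 3 * q)\<^sup>2 = 4 * (p\<^sup>2 - q\<^sup>2)" for p q :: real
    by (simp add: power2_eq_square algebra_simps)
  have lin: "(\<Sum>k<dim_col \<Phi>. \<Phi> $$ (i, k) * (c * x k - e * y k))
      = c * (\<Sum>k<dim_col \<Phi>. \<Phi> $$ (i, k) * x k) - e * (\<Sum>k<dim_col \<Phi>. \<Phi> $$ (i, k) * y k)" for i c e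
    by (simp add: sum_distrib_left sum_subtractf algebra_simps)
  have "isometry_defect \<Phi> (\<lambda>k. 10 / 3 * x k - 8 / 3 * y k) - isometry_defect \<Phi> (\<lambda>k. 8 / 3 * x k - 10 / 3 * y k)
     = (\<Sum>i<dim_row \<Phi>. 4 * ((\<Sum>k<dim_col \<Phi>. \<Phi> $$ (i, k) * x k)\<^sup>2 - (\<Sum>k<dim_col \<Phi>. \<Phi> $$ (i, k) * y k)\<^sup>2))
       - (\<Sum>k<dim_col \<Phi>. 4 * ((x k)\<^sup>2 - (y k)\<^sup>2))"
    unfolding isometry_defect_def lin sq[symmetric] sum_subtractf by simp
  then show ?thesis
    unfolding isometry_defect_def by (simp add: sum_distrib_left[symmetric] sum_subtractf algebra_simps)
qed

lemma isometry_defect_le_rip_const: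
  assumes "card {i. i < dim_col \<Phi> \<and> x i \<noteq> 0} \<le> s"
  shows "\<bar>isometry_defect \<Phi> x\<bar> \<le> rip_const s \<Phi> * (\<Sum>k<dim_col \<Phi>. (x k)\<^sup>2)"
proof -
  let ?d = "dim_col \<Phi>"
  define l where "l = (\<Sum>k<?d. (x k)\<^sup>2)"
  show ?thesis
  proof (cases "l = 0")
    case True
    then have "x k = 0" if "k < ?d" for k using that by (simp add: l_def sum_nonneg_eq_0_iff)
    then show ?thesis by (simp add: isometry_defect_def)
  next
    case False
    then have l: "0 < l" unfolding l_def by (simp add: less_le sum_nonneg)
    define z where "z = vec ?d (\<lambda>k. 1 / sqrt l * x k)"
    have z: "z \<in> carrier_vec ?d" "dim_vec z = ?d" by (auto simp: z_def)
    have "(\<Sum>k<?d. (z $ k)\<^sup>2) = (\<Sum>k<?d. (x k)\<^sup>2 / l)"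
      using l by (intro sum.cong) (auto simp: z_def power_divide)
    then have z1: "(\<Sum>k<?d. (z $ k)\<^sup>2) = 1"
      using l by (simp add: sum_divide_distrib[symmetric] l_def[symmetric])
    have "vec_l2_norm z = 1" using z1 z by (simp add: vec_l2_norm_def L2_set_def)
    moreover have "{j. j < dim_vec z \<and> z $ j \<noteq> 0} = {i. i < ?d \<and> x i \<noteq> 0}"
      using l by (auto simp: z_def)
    then have "vec_l0 z \<le> s" using assms by (simp add: vec_l0_def)
    ultimately have "\<bar>(vec_l2_norm (\<Phi> *\<^sub>v z))\<^sup>2 - 1\<bar> \<in> rip_deviations s \<Phi>"
      unfolding rip_deviations_def using z by blast
    then have "\<bar>(vec_l2_norm (\<Phi> *\<^sub>v z))\<^sup>2 - 1\<bar> \<le> rip_const s \<Phi>"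
      unfolding rip_const_def by (intro cSup_upper rip_deviations_bdd_above)
    moreover have "(vec_l2_norm (\<Phi> *\<^sub>v z))\<^sup>2 - 1 = isometry_defect \<Phi> (\<lambda>k. 1 / sqrt l * x k)"
    proof -
      have zk: "z $ k = 1 / sqrt l * x k" if "k < ?d" for k using that by (simp add: z_def)
      have "(\<Sum>k<?d. (1 / sqrt l * x k)\<^sup>2) = 1" using z1 zk by simp
      then show ?thesis
        unfolding isometry_defect_def mult_mat_vec_square[OF z(1)] using zk by simp
    qed
    ultimately have "\<bar>1 / l * isometry_defect \<Phi> x\<bar> \<le> rip_const s \<Phi>"
      unfolding isometry_defect_scale using l by (simp add: power_divide)
    then show ?thesis using l by (simp add: l_def[symmetric] abs_mult pos_divide_le_eq)
  qed
qed

text \<open>With M = \<open>rip_const s \<Phi>\<close>, passing from x to its grid point y costs at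
  most M/2, so M <= \<epsilon>/2 + M/2, and M, being a supremum of a bounded set, can be absorbed.
  Since y vanishes where x does, the polarised vectors are again s-sparse, so the same order s
  suffices on the right.\<close>

lemma rip_const_le_of_grid:
  assumes s: "1 \<le> s" "s \<le> dim_col \<Phi>" and "0 \<le> \<epsilon>"
    and grid: "\<And>n. n \<in> grid (dim_col \<Phi>) s \<Longrightarrow>
      \<bar>isometry_defect \<Phi> (grid_point s n)\<bar> \<le> \<epsilon> / 2 * (\<Sum>k<dim_col \<Phi>. (grid_point s n k)\<^sup>2)"
  shows "rip_const s \<Phi> \<le> \<epsilon>"
proof -
  let ?d = "dim_col \<Phi>" and ?M = "rip_const s \<Phi>"
  have ne: "rip_deviations s \<Phi> \<noteq> {}" using s by (intro rip_deviations_nonempty) auto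
  then obtain e where e: "e \<in> rip_deviations s \<Phi>" by blast
  then have "0 \<le> e" unfolding rip_deviations_def by auto
  also have "e \<le> ?M" unfolding rip_const_def using e by (intro cSup_upper rip_deviations_bdd_above)
  finally have M: "0 \<le> ?M" .
  have "\<bar>(vec_l2_norm (\<Phi> *\<^sub>v v))\<^sup>2 - 1\<bar> \<le> \<epsilon> / 2 + ?M / 2"
    if v: "v \<in> carrier_vec ?d" "vec_l2_norm v = 1" "vec_l0 v \<le> s" for v
  proof -
    define x where "x k = v $ k" for k
    have x1: "(\<Sum>k<?d. (x k)\<^sup>2) = 1"
      using vec_l2_norm_square[of v] v by (simp add: x_def)
    have x0: "card {i. i < ?d \<and> x i \<noteq> 0} \<le> s" using v by (simp add: vec_l0_def x_def)
    obtain n where n: "n \<in> grid ?d s" "\<And>i. i < ?d \<Longrightarrow> x i = 0 \<Longrightarrow> grid_point s n i = 0"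
      "(\<Sum>i<?d. (x i - grid_point s n i)\<^sup>2) \<le> 1 / 25" "(\<Sum>i<?d. (grid_point s n i)\<^sup>2) \<le> 1"
      using ex_grid_point_near[of s x ?d] s x1 x0 by auto
    define y where "y = grid_point s n"
    have sparse: "card {i. i < ?d \<and> z i \<noteq> 0} \<le> s" if "\<And>i. i < ?d \<Longrightarrow> x i = 0 \<Longrightarrow> z i = 0" for z :: "nat \<Rightarrow> real"
    proof -
      have "card {i. i < ?d \<and> z i \<noteq> 0} \<le> card {i. i < ?d \<and> x i \<noteq> 0}"
        using that by (intro card_mono) auto
      then show ?thesis using x0 by simp
    qed
    let ?p = "\<lambda>k. 10 / 3 * x k - 8 / 3 * y k" and ?q = "\<lambda>k. 8 / 3 * x k - 10 / 3 * y k"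
    have "\<bar>4 * (isometry_defect \<Phi> x - isometry_defect \<Phi> y)\<bar>
        \<le> \<bar>isometry_defect \<Phi> ?p\<bar> + \<bar>isometry_defect \<Phi> ?q\<bar>"
      unfolding isometry_defect_diff[symmetric] by (rule abs_triangle_ineq4)
    also have "\<dots> \<le> ?M * (\<Sum>k<?d. (?p k)\<^sup>2) + ?M * (\<Sum>k<?d. (?q k)\<^sup>2)"
      using n(2) by (intro add_mono isometry_defect_le_rip_const sparse) (auto simp: y_def)
    also have "\<dots> = ?M * (\<Sum>k<?d. (?p k)\<^sup>2 + (?q k)\<^sup>2)"
      by (simp add: sum.distrib distrib_left)
    also have "\<dots> \<le> ?M * 2"
    \<comment> \<open>The weight 3 in the polarization roughly balances 3 |x - y| <= 3/5 against |x
      + y| / 3 <= 2/3. The sum of the two squared norms is at most 18/25 + 8/9, below the 2 that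
      yields M/2 after division by 4.\<close>
    proof (rule mult_left_mono[OF _ M])
      have "(\<Sum>k<?d. (?p k)\<^sup>2 + (?q k)\<^sup>2)
          \<le> (\<Sum>k<?d. 18 * (x k - y k)\<^sup>2 + (4 / 9) * ((x k)\<^sup>2 + (y k)\<^sup>2))"
      proof (rule sum_mono)
        fix k
        have "18 * (x k - y k)\<^sup>2 + (4 / 9) * ((x k)\<^sup>2 + (y k)\<^sup>2) - ((?p k)\<^sup>2 + (?q k)\<^sup>2)
            = (2 / 9) * (x k - y k)\<^sup>2"
          by (simp add: power2_eq_square algebra_simps)
        also have "\<dots> \<ge> 0" by simp
        finally show "(?p k)\<^sup>2 + (?q k)\<^sup>2 \<le> 18 * (x k - y k)\<^sup>2 + (4 / 9) * ((x k)\<^sup>2 + (y k)\<^sup>2)" by simp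
      qed
      also have "\<dots> = 18 * (\<Sum>k<?d. (x k - y k)\<^sup>2) + (4 / 9) * ((\<Sum>k<?d. (x k)\<^sup>2) + (\<Sum>k<?d. (y k)\<^sup>2))"
        by (simp only: sum.distrib sum_distrib_left[symmetric])
      also have "\<dots> \<le> 18 * (1 / 25) + (4 / 9) * (1 + 1)"
        using n(3,4) x1 unfolding y_def by (intro add_mono mult_left_mono) auto
      also have "\<dots> \<le> 2" by simp
      finally show "(\<Sum>k<?d. (?p k)\<^sup>2 + (?q k)\<^sup>2) \<le> 2" .
    qed
    finally have "\<bar>isometry_defect \<Phi> x - isometry_defect \<Phi> y\<bar> \<le> ?M / 2" unfolding abs_mult by simp
    moreover have "\<bar>isometry_defect \<Phi> y\<bar> \<le> \<epsilon> / 2 * 1"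
      using grid[OF n(1)] mult_left_mono[OF n(4), of "\<epsilon> / 2"] \<open>0 \<le> \<epsilon>\<close> unfolding y_def by linarith
    ultimately have "\<bar>isometry_defect \<Phi> x\<bar> \<le> \<epsilon> / 2 + ?M / 2" by linarith
    moreover have "(vec_l2_norm (\<Phi> *\<^sub>v v))\<^sup>2 - 1 = isometry_defect \<Phi> x"
      unfolding mult_mat_vec_square[OF v(1)] isometry_defect_def x1 by (simp add: x_def)
    ultimately show ?thesis by simp
  qed
  then have "?M \<le> \<epsilon> / 2 + ?M / 2"
    unfolding rip_const_def by (intro cSup_least ne) (auto simp: rip_deviations_def rip_const_def)
  then show ?thesis by simp
qed

section \<open>The random map\<close>

text \<open>Applied to the columns of B it gives |y| = 1; applied to the rows of A indexed by I it
  gives \<open>dual_le\<close>.\<close>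

lemma orthonormal_sum_square:
  fixes M :: "nat \<Rightarrow> nat \<Rightarrow> real"
  assumes "finite J" and orth: "\<And>i j. i \<in> J \<Longrightarrow> j \<in> J \<Longrightarrow> (\<Sum>k\<in>K. M k i * M k j) = of_bool (i = j)"
  shows "(\<Sum>k\<in>K. (\<Sum>j\<in>J. M k j * v j)\<^sup>2) = (\<Sum>j\<in>J. (v j)\<^sup>2)"
proof -
  have "(\<Sum>k\<in>K. (\<Sum>j\<in>J. M k j * v j)\<^sup>2) = (\<Sum>k\<in>K. \<Sum>i\<in>J. \<Sum>j\<in>J. v i * v j * (M k i * M k j))"
    by (simp add: power2_eq_square sum_product mult_ac)
  also have "\<dots> = (\<Sum>i\<in>J. \<Sum>k\<in>K. \<Sum>j\<in>J. v i * v j * (M k i * M k j))" by (rule sum.swap)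
  also have "\<dots> = (\<Sum>i\<in>J. \<Sum>j\<in>J. \<Sum>k\<in>K. v i * v j * (M k i * M k j))"
    by (intro sum.cong refl sum.swap)
  also have "\<dots> = (\<Sum>i\<in>J. \<Sum>j\<in>J. v i * v j * of_bool (i = j))"
    using orth by (intro sum.cong refl) (simp add: sum_distrib_left[symmetric])
  also have "\<dots> = (\<Sum>j\<in>J. (v j)\<^sup>2)"
    using assms(1) by (intro sum.cong refl) (simp add: power2_eq_square of_bool_def if_distrib cong: if_cong)
  finally show ?thesis .
qed

lemma orthogonal_group_columns:
  assumes "B \<in> orthogonal_group d" "i < d" "j < d"
  shows "(\<Sum>k<d. B $$ (k, i) * B $$ (k, j)) = of_bool (i = j)"
proof -
  have B: "B \<in> carrier_mat d d" "B\<^sup>T * B = 1\<^sub>m d" using assms by (auto simp: orthogonal_group_def)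
  have "(B\<^sup>T * B) $$ (i, j) = (\<Sum>k<d. B $$ (k, i) * B $$ (k, j))"
    using B(1) assms(2,3) by (auto simp: scalar_prod_def atLeast0LessThan)
  then show ?thesis unfolding B(2) using assms by (simp add: of_bool_def)
qed

lemma orthogonal_group_rows:
  assumes "A \<in> orthogonal_group d" "i < d" "j < d"
  shows "(\<Sum>k<d. A $$ (i, k) * A $$ (j, k)) = of_bool (i = j)"
proof -
  have A: "A \<in> carrier_mat d d" "A * A\<^sup>T = 1\<^sub>m d" using assms by (auto simp: orthogonal_group_def)
  have "(A * A\<^sup>T) $$ (i, j) = (\<Sum>k<d. A $$ (i, k) * A $$ (j, k))"
    using A(1) assms(2,3) by (auto simp: scalar_prod_def atLeast0LessThan)
  then show ?thesis unfolding A(2) using assms by (simp add: of_bool_def)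
qed

lemma bij_betw_pick:
  assumes "finite I"
  shows "bij_betw (pick I) {..<card I} I"
proof -
  have inj: "inj_on (pick I) {..<card I}"
    by (rule strict_mono_on_imp_inj_on) (auto simp: strict_mono_on_def intro: pick_mono_le)
  have "pick I ` {..<card I} \<subseteq> I" using pick_in_set_le by auto
  then have "pick I ` {..<card I} = I"
    using inj assms by (intro card_subset_eq) (auto simp: card_image)
  then show ?thesis using inj by (simp add: bij_betw_def)
qed

text \<open>The coordinates of \<Phi> x are indexed by the elements of I instead of their ranks, and
  the product is grouped like \<open>V\<close> in \<open>sampled_chaos\<close>, with the inner sum
  as \<open>y\<close> and the last factor as \<open>w\<close>.\<close>

definition coord_map ::
    "nat \<Rightarrow> nat set \<Rightarrow> real mat \<Rightarrow> real mat \<Rightarrow>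
     (nat \<Rightarrow> real) \<Rightarrow> (nat \<Rightarrow> real) \<Rightarrow> (nat \<Rightarrow> nat) \<Rightarrow> (nat \<Rightarrow> real) \<Rightarrow> nat \<Rightarrow> real" where
  "coord_map d I A B \<xi> \<zeta> \<pi> x j =
     (\<Sum>k<d. \<xi> k * (\<Sum>l<d. B $$ (\<pi> k, l) * (\<zeta> l * x l)) * (sqrt (real d / real (card I)) * A $$ (j, k)))"

lemma mat_diag_mult_vec:
  assumes "x \<in> carrier_vec d" "k < d"
  shows "(mat_diag d f *\<^sub>v x) $ k = f k * x $ k"
proof -
  have "(mat_diag d f *\<^sub>v x) $ k = (\<Sum>j<d. (if k = j then f j else 0) * x $ j)"
    using assms by (auto simp: mat_diag_def scalar_prod_def atLeast0LessThan intro!: sum.cong)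
  also have "\<dots> = (\<Sum>j<d. if k = j then f j * x $ j else 0)" by (intro sum.cong) auto
  finally show ?thesis using assms by simp
qed

lemma random_map_carrier:
  assumes "A \<in> carrier_mat d d" "B \<in> carrier_mat d d" "I \<subseteq> {..<d}"
  shows "random_map d I A B \<xi> \<zeta> \<pi> \<in> carrier_mat (card I) d"
  unfolding random_map_def perm_mat_def
  by (intro smult_carrier_mat mult_carrier_mat[where n = d] restriction_mat_carrier assms) simp_all

lemma random_map_mult_vec:
  assumes A: "A \<in> carrier_mat d d" and B: "B \<in> carrier_mat d d" and I: "I \<subseteq> {..<d}"
    and \<pi>: "\<pi> permutes {..<d}" and x: "x \<in> carrier_vec d" and i: "i < card I"
  shows "(random_map d I A B \<xi> \<zeta> \<pi> *\<^sub>v x) $ i = coord_map d I A B \<xi> \<zeta> \<pi> (\<lambda>l. x $ l) (pick I i)"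
proof -
  let ?c = "sqrt (real d / real (card I))"
  let ?R = "restriction_mat d I" and ?D = "mat_diag d \<xi>" and ?P = "perm_mat d \<pi>" and ?E = "mat_diag d \<zeta>"
  have R: "?R \<in> carrier_mat (card I) d" by (rule restriction_mat_carrier[OF I])
  have P: "?P \<in> carrier_mat d d" by (simp add: perm_mat_def)
  note [simp] = mat_diag_dim
  have p: "pick I i < d" using pick_in_set_le[OF i] I by auto
  define u1 where "u1 = ?E *\<^sub>v x"
  define u2 where "u2 = B *\<^sub>v u1"
  define u3 where "u3 = ?P *\<^sub>v u2"
  define u4 where "u4 = ?D *\<^sub>v u3"
  define u5 where "u5 = A *\<^sub>v u4"
  have u: "u1 \<in> carrier_vec d" "u2 \<in> carrier_vec d" "u3 \<in> carrier_vec d" "u4 \<in> carrier_vec d" "u5 \<in> carrier_vec d"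
    unfolding u1_def u2_def u3_def u4_def u5_def
    using A B P x by (auto intro!: mult_mat_vec_carrier[of _ d d])
  have RA: "?R * A \<in> carrier_mat (card I) d" using R A by auto
  have RAD: "?R * A * ?D \<in> carrier_mat (card I) d" using RA by auto
  have RADP: "?R * A * ?D * ?P \<in> carrier_mat (card I) d" using RAD P by auto
  have RADPB: "?R * A * ?D * ?P * B \<in> carrier_mat (card I) d" using RADP B by auto
  have "(?R * A * ?D * ?P * B * ?E) *\<^sub>v x = (?R * A * ?D * ?P * B) *\<^sub>v u1"
    unfolding u1_def by (rule assoc_mult_mat_vec[OF RADPB mat_diag_dim x])
  also have "\<dots> = (?R * A * ?D * ?P) *\<^sub>v u2"
    unfolding u2_def by (rule assoc_mult_mat_vec[OF RADP B u(1)])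
  also have "\<dots> = (?R * A * ?D) *\<^sub>v u3"
    unfolding u3_def by (rule assoc_mult_mat_vec[OF RAD P u(2)])
  also have "\<dots> = (?R * A) *\<^sub>v u4"
    unfolding u4_def by (rule assoc_mult_mat_vec[OF RA mat_diag_dim u(3)])
  also have "\<dots> = ?R *\<^sub>v u5"
    unfolding u5_def by (rule assoc_mult_mat_vec[OF R A u(4)])
  finally have "(?R * A * ?D * ?P * B * ?E) *\<^sub>v x = ?R *\<^sub>v u5" .
  moreover have RADPBE: "?R * A * ?D * ?P * B * ?E \<in> carrier_mat (card I) d" using RADPB by auto
  moreover have smult: "((?c \<cdot>\<^sub>m \<Psi>) *\<^sub>v x) $ i = ?c * (\<Psi> *\<^sub>v x) $ i"
    if "\<Psi> \<in> carrier_mat (card I) d" for \<Psi> :: "real mat"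
    using that x i by (auto simp: scalar_prod_def sum_distrib_left mult.assoc)
  ultimately have "(random_map d I A B \<xi> \<zeta> \<pi> *\<^sub>v x) $ i = ?c * (?R *\<^sub>v u5) $ i"
    unfolding random_map_def by (simp only: smult[OF RADPBE])
  also have "(?R *\<^sub>v u5) $ i = u5 $ pick I i" by (rule restriction_mat_mult_vec[OF I u(5) i])
  also have "\<dots> = (\<Sum>k<d. A $$ (pick I i, k) * u4 $ k)"
    unfolding u5_def using A u(4) p by (auto simp: scalar_prod_def atLeast0LessThan intro!: sum.cong)
  also have "\<dots> = (\<Sum>k<d. A $$ (pick I i, k) * (\<xi> k * (\<Sum>l<d. B $$ (\<pi> k, l) * (\<zeta> l * x $ l))))"
  proof (intro sum.cong refl arg_cong2[where f = "(*)"])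
    fix k assume "k \<in> {..<d}"
    then have k: "k < d" by simp
    have pk: "\<pi> k < d" using k permutes_in_image[OF \<pi>, of k] by auto
    have "u4 $ k = \<xi> k * u3 $ k" unfolding u4_def by (rule mat_diag_mult_vec[OF u(3) k])
    also have "u3 $ k = u2 $ \<pi> k" unfolding u3_def by (rule perm_mat_mult_vec[OF \<pi> u(2) k])
    also have "u2 $ \<pi> k = (\<Sum>l<d. B $$ (\<pi> k, l) * u1 $ l)"
      unfolding u2_def using B u(1) pk by (auto simp: scalar_prod_def atLeast0LessThan intro!: sum.cong)
    also have "\<dots> = (\<Sum>l<d. B $$ (\<pi> k, l) * (\<zeta> l * x $ l))"
      unfolding u1_def using mat_diag_mult_vec[OF x] by (intro sum.cong) auto
    finally show "u4 $ k = \<xi> k * (\<Sum>l<d. B $$ (\<pi> k, l) * (\<zeta> l * x $ l))" .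
  qed
  finally show ?thesis
    unfolding coord_map_def by (simp add: sum_distrib_left mult_ac)
qed

lemma isometry_defect_random_map:
  assumes A: "A \<in> carrier_mat d d" and B: "B \<in> carrier_mat d d" and I: "I \<subseteq> {..<d}"
    and \<pi>: "\<pi> permutes {..<d}"
  shows "isometry_defect (random_map d I A B \<xi> \<zeta> \<pi>) x
     = (\<Sum>j\<in>I. (coord_map d I A B \<xi> \<zeta> \<pi> x j)\<^sup>2) - (\<Sum>k<d. (x k)\<^sup>2)"
proof -
  let ?\<Phi> = "random_map d I A B \<xi> \<zeta> \<pi>" and ?x = "vec d x"
  have \<Phi>: "?\<Phi> \<in> carrier_mat (card I) d" by (rule random_map_carrier[OF A B I])
  have "(\<Sum>k<d. ?\<Phi> $$ (i, k) * x k) = coord_map d I A B \<xi> \<zeta> \<pi> x (pick I i)" if "i < card I" for i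
  proof -
    have "(\<Sum>k<d. ?\<Phi> $$ (i, k) * x k) = (?\<Phi> *\<^sub>v ?x) $ i"
      using \<Phi> that by (auto simp: scalar_prod_def atLeast0LessThan intro!: sum.cong)
    also have "\<dots> = coord_map d I A B \<xi> \<zeta> \<pi> (\<lambda>l. ?x $ l) (pick I i)"
      by (rule random_map_mult_vec[OF A B I \<pi> _ that]) simp
    also have "\<dots> = coord_map d I A B \<xi> \<zeta> \<pi> x (pick I i)"
      unfolding coord_map_def by simp
    finally show ?thesis .
  qed
  then have "(\<Sum>i<card I. (\<Sum>k<d. ?\<Phi> $$ (i, k) * x k)\<^sup>2)
      = (\<Sum>i<card I. (coord_map d I A B \<xi> \<zeta> \<pi> x (pick I i))\<^sup>2)" by simp
  also have "\<dots> = (\<Sum>j\<in>I. (coord_map d I A B \<xi> \<zeta> \<pi> x j)\<^sup>2)"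
    using I finite_subset by (intro sum.reindex_bij_betw bij_betw_pick) auto
  finally show ?thesis unfolding isometry_defect_def using \<Phi> by simp
qed

lemma mat_max_norm_ge:
  assumes "B \<in> carrier_mat d d" "i < d" "j < d"
  shows "\<bar>B $$ (i, j)\<bar> \<le> mat_max_norm B"
proof -
  have "\<bar>B $$ (i, j)\<bar> \<in> (\<lambda>(i, j). \<bar>B $$ (i, j)\<bar>) ` ({..<dim_row B} \<times> {..<dim_col B})"
    using assms by force
  then show ?thesis unfolding mat_max_norm_def by (intro Max_ge) auto
qed

lemma kappa_ge:
  assumes "A \<in> carrier_mat d d" "k < d"
  shows "(\<Sum>j\<in>I. (sqrt (real d / real (card I)) * A $$ (j, k))\<^sup>2) \<le> kappa I A"
proof -
  have dim: "dim_row A = d" using assms by simp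
  have "(\<Sum>j\<in>I. (A $$ (j, k))\<^sup>2) \<le> (MAX k\<in>{..<d}. \<Sum>j\<in>I. (A $$ (j, k))\<^sup>2)"
    using assms by (intro Max_ge) auto
  then have "real d / real (card I) * (\<Sum>j\<in>I. (A $$ (j, k))\<^sup>2) \<le> kappa I A"
    unfolding kappa_def dim by (rule mult_left_mono) simp
  moreover have "(\<Sum>j\<in>I. (sqrt (real d / real (card I)) * A $$ (j, k))\<^sup>2)
      = real d / real (card I) * (\<Sum>j\<in>I. (A $$ (j, k))\<^sup>2)"
    unfolding sum_distrib_left by (intro sum.cong) (auto simp: power_mult_distrib)
  ultimately show ?thesis by simp
qed

section \<open>Tail bounds for one fixed vector\<close>

lemma unit_vector_tail:
  fixes x :: "nat \<Rightarrow> real"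
  assumes A: "A \<in> orthogonal_group d" and B: "B \<in> orthogonal_group d" and I: "I \<subseteq> {..<d}"
    and a: "1 \<le> a" and m: "2025 * a \<le> real (card I)"
    and flat: "144 * kappa I A * (mat_max_norm B)\<^sup>2 * real (card I) * a\<^sup>2 \<le> 1"
    and x: "(\<Sum>k<d. (x k)\<^sup>2) = 1"
  shows "freq (sign_vectors d \<times> sign_vectors d \<times> {\<pi>. \<pi> permutes {..<d}})
     (\<lambda>(\<xi>, \<zeta>, \<pi>). 45 / 2 * sqrt (a / card I) < \<bar>isometry_defect (random_map d I A B \<xi> \<zeta> \<pi>) x\<bar>)
    \<le> 6 * (real d)\<^sup>2 * exp (- a)"
proof -
  let ?S = "sign_vectors d" and ?P = "{\<pi>. \<pi> permutes {..<d}}"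
  let ?m = "real (card I)"
  have Ac: "A \<in> carrier_mat d d" and Bc: "B \<in> carrier_mat d d"
    using A B by (auto simp: orthogonal_group_def)
  have fI: "finite I" using I finite_subset by auto
  have mpos: "0 < ?m" using m a by linarith
  have card_le: "card I \<le> d" using card_mono[OF _ I] by simp
  have d: "0 < d" using card_le mpos by simp
  define \<mu> where "\<mu> = mat_max_norm B"
  \<comment> \<open>The square of the threshold of \<open>rademacher_tail\<close> with V = \<mu>^2
    and t = a.\<close>
  define b where "b = 2 * \<mu>\<^sup>2 * a"
  have Ble: "(B $$ (k, l))\<^sup>2 \<le> \<mu>\<^sup>2" if "k < d" "l < d" for k l
    using mat_max_norm_ge[OF Bc that] unfolding \<mu>_def
    by (metis abs_ge_zero power2_abs power_mono)
  \<comment> \<open>\<open>rademacher_tail\<close> asks for a positive variance bound; \<mu> = 0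
    would make a column of B vanish.\<close>
  have \<mu>: "0 < \<mu>\<^sup>2"
  proof (rule ccontr)
    assume "\<not> 0 < \<mu>\<^sup>2"
    then have "\<mu>\<^sup>2 = 0" using zero_le_power2[of \<mu>] by linarith
    then have "B $$ (k, 0) = 0" if "k < d" for k using Ble[OF that d] by simp
    then show False using orthogonal_group_columns[OF B d d] by simp
  qed
  define y where "y \<zeta> k = (\<Sum>l<d. B $$ (k, l) * (\<zeta> l * x l))" for \<zeta> :: "nat \<Rightarrow> real" and k
  define w where "w j k = sqrt (real d / ?m) * A $$ (j, k)" for j k
  let ?bad = "\<lambda>\<xi> \<zeta> \<pi>. 45 / 2 * sqrt (a / ?m) < \<bar>isometry_defect (random_map d I A B \<xi> \<zeta> \<pi>) x\<bar>"
  have y_unit: "(\<Sum>k<d. (y \<zeta> k)\<^sup>2) = 1" if "\<zeta> \<in> ?S" for \<zeta>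
  proof -
    have "(\<Sum>k<d. (y \<zeta> k)\<^sup>2) = (\<Sum>l<d. (\<zeta> l * x l)\<^sup>2)"
      unfolding y_def by (rule orthonormal_sum_square) (use orthogonal_group_columns[OF B] in auto)
    also have "\<dots> = (\<Sum>l<d. (x l)\<^sup>2)"
      using sign_vectors_square[OF that] by (intro sum.cong) (auto simp: power_mult_distrib power2_eq_square)
    finally show ?thesis using x by simp
  qed
  have good: "freq (?S \<times> ?P) (\<lambda>p. ?bad (fst p) \<zeta> (snd p)) \<le> 4 * (real d)\<^sup>2 * exp (- a)"
    if \<zeta>: "\<zeta> \<in> ?S" and yb: "\<And>k. k < d \<Longrightarrow> (y \<zeta> k)\<^sup>2 \<le> b" for \<zeta>
  proof -
    interpret sampled_chaos d I w "y \<zeta>" ?m a "kappa I A" b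
    proof
      show "finite I" "(\<Sum>k<d. (y \<zeta> k)\<^sup>2) = 1" by (fact fI, rule y_unit[OF \<zeta>])
      show "(y \<zeta> k)\<^sup>2 \<le> b" if "k < d" for k by (rule yb[OF that])
      show "(\<Sum>j\<in>I. (w j k)\<^sup>2) \<le> kappa I A" if "k < d" for k
        unfolding w_def by (rule kappa_ge[OF Ac that])
      have row: "(\<Sum>k<d. (A $$ (j, k))\<^sup>2) = 1" if "j \<in> I" for j
        using orthogonal_group_rows[OF A, of j j] that I by (auto simp: power2_eq_square)
      have "(\<Sum>k<d. \<Sum>j\<in>I. (w j k)\<^sup>2) = (\<Sum>j\<in>I. \<Sum>k<d. (w j k)\<^sup>2)" by (rule sum.swap)
      also have "\<dots> = (\<Sum>j\<in>I. real d / ?m * (\<Sum>k<d. (A $$ (j, k))\<^sup>2))"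
        unfolding w_def by (simp add: power_mult_distrib sum_distrib_left)
      also have "\<dots> = real d" using row mpos by simp
      finally show "(\<Sum>k<d. \<Sum>j\<in>I. (w j k)\<^sup>2) = real d" .
      show "(\<Sum>k<d. (\<Sum>j\<in>I. w j k * v j)\<^sup>2) \<le> real d / ?m * (\<Sum>j\<in>I. (v j)\<^sup>2)" for v
      proof -
        have "(\<Sum>k<d. (\<Sum>j\<in>I. w j k * v j)\<^sup>2) = (\<Sum>k<d. real d / ?m * (\<Sum>j\<in>I. A $$ (j, k) * v j)\<^sup>2)"
          unfolding w_def
          by (simp add: mult.assoc sum_distrib_left[symmetric] power_mult_distrib)
        also have "\<dots> = real d / ?m * (\<Sum>k<d. (\<Sum>j\<in>I. A $$ (j, k) * v j)\<^sup>2)"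
          by (simp only: sum_distrib_left)
        also have "(\<Sum>k<d. (\<Sum>j\<in>I. A $$ (j, k) * v j)\<^sup>2) = (\<Sum>j\<in>I. (v j)\<^sup>2)"
        proof (rule orthonormal_sum_square[OF fI])
          fix i j assume "i \<in> I" "j \<in> I"
          then have "i < d" "j < d" using I by auto
          then show "(\<Sum>k<d. A $$ (i, k) * A $$ (j, k)) = of_bool (i = j)"
            by (rule orthogonal_group_rows[OF A])
        qed
        finally show ?thesis by simp
      qed
      show "?m \<le> real d" using card_le by simp
      show "1 \<le> a" "2025 * a \<le> ?m" by (fact a, fact m)
      show "72 * (kappa I A * b) * ?m * a \<le> 1"
        using flat by (simp add: b_def \<mu>_def power2_eq_square mult_ac)
    qed
    have "freq (?S \<times> ?P) (\<lambda>p. ?bad (fst p) \<zeta> (snd p))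
        \<le> freq (?S \<times> ?P) (\<lambda>p. 45 / 2 * r < \<bar>X (fst p) (snd p) - 1\<bar>)"
    proof (rule freq_mono)
      fix p assume p: "p \<in> ?S \<times> ?P" "?bad (fst p) \<zeta> (snd p)"
      have "isometry_defect (random_map d I A B (fst p) \<zeta> (snd p)) x = X (fst p) (snd p) - 1"
        using p x
        by (subst isometry_defect_random_map[OF Ac Bc I])
          (auto simp: X_def N_def V_def y_def w_def coord_map_def)
      then show "45 / 2 * r < \<bar>X (fst p) (snd p) - 1\<bar>" using p by (simp add: r_def)
    qed
    also have "\<dots> \<le> 4 * (real d)\<^sup>2 * exp (- a)" by (rule chaos_tail)
    finally show ?thesis .
  qed
  let ?large = "\<lambda>\<zeta>. \<exists>k\<in>{..<d}. sqrt (2 * \<mu>\<^sup>2 * a) \<le> \<bar>y \<zeta> k\<bar>"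
  have "freq ?S ?large \<le> (\<Sum>k<d. freq ?S (\<lambda>\<zeta>. sqrt (2 * \<mu>\<^sup>2 * a) \<le> \<bar>y \<zeta> k\<bar>))"
    by (rule freq_Bex_le) simp
  also have "\<dots> \<le> (\<Sum>k<d. 2 * exp (- a))"
  proof (rule sum_mono)
    fix k assume k: "k \<in> {..<d}"
    have "(\<Sum>l<d. (B $$ (k, l) * x l)\<^sup>2) \<le> (\<Sum>l<d. \<mu>\<^sup>2 * (x l)\<^sup>2)"
      using Ble k by (intro sum_mono) (auto simp: power_mult_distrib intro: mult_right_mono)
    also have "\<dots> = \<mu>\<^sup>2" using x by (simp add: sum_distrib_left[symmetric])
    finally have "freq ?S (\<lambda>\<zeta>. sqrt (2 * \<mu>\<^sup>2 * a) \<le> \<bar>\<Sum>l<d. \<zeta> l * (B $$ (k, l) * x l)\<bar>) \<le> 2 * exp (- a)"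
      using \<mu> a by (intro rademacher_tail) auto
    then show "freq ?S (\<lambda>\<zeta>. sqrt (2 * \<mu>\<^sup>2 * a) \<le> \<bar>y \<zeta> k\<bar>) \<le> 2 * exp (- a)"
      unfolding y_def by (simp add: mult.left_commute)
  qed
  finally have large: "freq ?S ?large \<le> 2 * real d * exp (- a)" by simp
  have "freq (?S \<times> ?S \<times> ?P) (\<lambda>(\<xi>, \<zeta>, \<pi>). ?bad \<xi> \<zeta> \<pi>)
      = avg ?S (\<lambda>\<xi>. avg ?S (\<lambda>\<zeta>. freq ?P (\<lambda>\<pi>. ?bad \<xi> \<zeta> \<pi>)))"
    by (simp only: avg_Times prod.case)
  \<comment> \<open>\<xi>' is moved outermost because it is fixed first: for a good value
    \<open>chaos_tail\<close> applies, and a bad value is simply counted as a failure.\<close>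
  also have "\<dots> = avg ?S (\<lambda>\<zeta>. avg ?S (\<lambda>\<xi>. freq ?P (\<lambda>\<pi>. ?bad \<xi> \<zeta> \<pi>)))" by (rule avg_swap)
  also have "\<dots> \<le> avg ?S (\<lambda>\<zeta>. 4 * (real d)\<^sup>2 * exp (- a) + of_bool (?large \<zeta>))"
  proof (rule avg_mono)
    fix \<zeta> assume \<zeta>: "\<zeta> \<in> ?S"
    have eq: "avg ?S (\<lambda>\<xi>. freq ?P (\<lambda>\<pi>. ?bad \<xi> \<zeta> \<pi>)) = freq (?S \<times> ?P) (\<lambda>p. ?bad (fst p) \<zeta> (snd p))"
      by (simp only: avg_Times fst_conv snd_conv)
    show "avg ?S (\<lambda>\<xi>. freq ?P (\<lambda>\<pi>. ?bad \<xi> \<zeta> \<pi>)) \<le> 4 * (real d)\<^sup>2 * exp (- a) + of_bool (?large \<zeta>)"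
    proof (cases "?large \<zeta>")
      case True
      have "freq (?S \<times> ?P) (\<lambda>p. ?bad (fst p) \<zeta> (snd p)) \<le> 1"
        using sign_vectors_finite_nonempty[of d] permutations_finite_nonempty[of d]
        by (intro avg_le_const) auto
      moreover have "0 \<le> 4 * (real d)\<^sup>2 * exp (- a)" by simp
      ultimately show ?thesis unfolding eq using True by (simp only: of_bool_eq)
    next
      case False
      have "(y \<zeta> k)\<^sup>2 \<le> b" if "k < d" for k
      proof -
        have "\<bar>y \<zeta> k\<bar> < sqrt (2 * \<mu>\<^sup>2 * a)" using False that by (auto simp: not_le)
        then have "\<bar>y \<zeta> k\<bar>\<^sup>2 \<le> (sqrt (2 * \<mu>\<^sup>2 * a))\<^sup>2" by (intro power_mono) auto
        then show ?thesis using a by (simp add: b_def)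
      qed
      then show ?thesis unfolding eq using good[OF \<zeta>] False by simp
    qed
  qed
  also have "\<dots> = 4 * (real d)\<^sup>2 * exp (- a) + freq ?S ?large"
    unfolding avg_add using sign_vectors_finite_nonempty[of d] by (simp add: avg_const)
  also have "\<dots> \<le> 4 * (real d)\<^sup>2 * exp (- a) + 2 * (real d)\<^sup>2 * exp (- a)"
  proof -
    have "real d \<le> (real d)\<^sup>2" using d by (simp add: power2_eq_square)
    then have "2 * real d * exp (- a) \<le> 2 * (real d)\<^sup>2 * exp (- a)" by simp
    then show ?thesis using large by linarith
  qed
  also have "\<dots> = 6 * (real d)\<^sup>2 * exp (- a)" by simp
  finally show ?thesis .
qed

text \<open>Grid points are not normalised, so the unit-vector bound is rescaled by homogeneity. For
  the zero vector the strict inequality makes the event empty.\<close>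

lemma vector_tail:
  fixes x :: "nat \<Rightarrow> real"
  assumes A: "A \<in> orthogonal_group d" and B: "B \<in> orthogonal_group d" and I: "I \<subseteq> {..<d}"
    and a: "1 \<le> a" and m: "2025 * a \<le> real (card I)"
    and flat: "144 * kappa I A * (mat_max_norm B)\<^sup>2 * real (card I) * a\<^sup>2 \<le> 1"
  shows "freq (sign_vectors d \<times> sign_vectors d \<times> {\<pi>. \<pi> permutes {..<d}})
     (\<lambda>(\<xi>, \<zeta>, \<pi>). 45 / 2 * sqrt (a / card I) * (\<Sum>k<d. (x k)\<^sup>2)
        < \<bar>isometry_defect (random_map d I A B \<xi> \<zeta> \<pi>) x\<bar>)
    \<le> 6 * (real d)\<^sup>2 * exp (- a)"
proof -
  let ?A = "sign_vectors d \<times> sign_vectors d \<times> {\<pi>. \<pi> permutes {..<d}}"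
  let ?q = "45 / 2 * sqrt (a / card I)"
  have Ac: "A \<in> carrier_mat d d" and Bc: "B \<in> carrier_mat d d"
    using A B by (auto simp: orthogonal_group_def)
  define l where "l = (\<Sum>k<d. (x k)\<^sup>2)"
  show ?thesis
  proof (cases "l = 0")
    case True
    then have x0: "x k = 0" if "k < d" for k using that by (simp add: l_def sum_nonneg_eq_0_iff)
    have "dim_col (random_map d I A B \<xi> \<zeta> \<pi>) = d" for \<xi> \<zeta> \<pi>
      using random_map_carrier[OF Ac Bc I] by blast
    then have "isometry_defect (random_map d I A B \<xi> \<zeta> \<pi>) x = 0" for \<xi> \<zeta> \<pi>
      using x0 by (simp add: isometry_defect_def)
    then show ?thesis using True by (simp add: l_def[symmetric] avg_def case_prod_beta)
  next
    case False
    then have l: "0 < l" unfolding l_def by (simp add: less_le sum_nonneg)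
    let ?z = "\<lambda>k. 1 / sqrt l * x k"
    have "(\<Sum>k<d. (?z k)\<^sup>2) = 1 / l * (\<Sum>k<d. (x k)\<^sup>2)"
      unfolding sum_distrib_left using l by (intro sum.cong) (auto simp: power_divide)
    then have z: "(\<Sum>k<d. (?z k)\<^sup>2) = 1" using l by (simp add: l_def[symmetric])
    have "freq ?A (\<lambda>(\<xi>, \<zeta>, \<pi>). ?q * l < \<bar>isometry_defect (random_map d I A B \<xi> \<zeta> \<pi>) x\<bar>)
      = freq ?A (\<lambda>(\<xi>, \<zeta>, \<pi>). ?q < \<bar>isometry_defect (random_map d I A B \<xi> \<zeta> \<pi>) ?z\<bar>)"
    proof -
      have "?q < \<bar>isometry_defect \<Phi> ?z\<bar> \<longleftrightarrow> ?q * l < \<bar>isometry_defect \<Phi> x\<bar>" for \<Phi>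
        unfolding isometry_defect_scale using l by (simp add: power_divide abs_mult pos_less_divide_eq)
      then show ?thesis by (simp add: case_prod_beta)
    qed
    also have "\<dots> \<le> 6 * (real d)\<^sup>2 * exp (- a)" by (rule unit_vector_tail[OF A B I a m flat z])
    finally show ?thesis by (simp only: l_def)
  qed
qed

section \<open>The probability space and the union bound over the net\<close>

lemma pair_pmf_of_set:
  assumes "finite S" "S \<noteq> {}" "finite T" "T \<noteq> {}"
  shows "pair_pmf (pmf_of_set S) (pmf_of_set T) = pmf_of_set (S \<times> T)"
proof (rule pmf_eqI)
  fix x :: "'a \<times> 'b"
  obtain a b where "x = (a, b)" by (cases x)
  moreover have "finite (S \<times> T)" "S \<times> T \<noteq> {}" using assms by auto
  ultimately show "pmf (pair_pmf (pmf_of_set S) (pmf_of_set T)) x = pmf (pmf_of_set (S \<times> T)) x"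
    using assms by (simp only: pmf_pair pmf_of_set) (simp add: indicator_def card_cartesian_product)
qed

lemma prob_randomness:
  "measure_pmf.prob (randomness d) {x. P x}
     = freq (sign_vectors d \<times> sign_vectors d \<times> {\<pi>. \<pi> permutes {..<d}}) P"
proof -
  let ?A = "sign_vectors d \<times> sign_vectors d \<times> {\<pi>. \<pi> permutes {..<d}}"
  have A: "finite ?A" "?A \<noteq> {}"
    using sign_vectors_finite_nonempty[of d] permutations_finite_nonempty[of d] by auto
  have "randomness d = pmf_of_set ?A"
    unfolding randomness_def
    using sign_vectors_finite_nonempty[of d] permutations_finite_nonempty[of d]
    by (simp add: pair_pmf_of_set)
  then have "measure_pmf.prob (randomness d) {x. P x} = card (?A \<inter> {x. P x}) / card ?A"
    using A by (simp add: measure_pmf_of_set)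
  also have "real (card (?A \<inter> {x. P x})) = (\<Sum>x\<in>?A. of_bool (P x))"
    using A by (simp add: of_bool_def sum.If_cases)
  finally show ?thesis unfolding avg_def .
qed

text \<open>On [1, d] the function s log(e d / s) increases, and its value at s = 1 is 1 + log d.
  Here ln s <= s - 1 replaces a monotonicity argument by derivatives.\<close>

lemma sparsity_ge:
  assumes "1 \<le> s" "s \<le> d"
  shows "1 + ln (real d) \<le> real s * ln (exp 1 * real d / real s)"
proof -
  have s: "1 \<le> real s" "real s \<le> real d" using assms by auto
  have "ln (real s) \<le> ln (real d)" using s by simp
  then have "(real s - 1) * ln (real s) \<le> (real s - 1) * ln (real d)"
    using s by (intro mult_left_mono) auto
  moreover have "ln (real s) \<le> real s - 1" using s by (intro ln_le_minus_one) auto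
  moreover have *: "ln (exp 1 * real d / real s) = 1 + ln (real d) - ln (real s)"
    using s by (simp add: ln_mult ln_div)
  ultimately show ?thesis unfolding * by (simp add: algebra_simps)
qed

theorem corollary5p6:
  shows "\<exists>C::real. C > 0 \<and>
    (\<forall>(d::nat) (s::nat) (m::nat) (\<epsilon>::real) (\<eta>::real) (A::real mat) (B::real mat) (I::nat set).
       1 \<le> s \<longrightarrow> s \<le> d \<longrightarrow>
       0 < \<epsilon> \<longrightarrow> \<epsilon> < 1 \<longrightarrow> 0 < \<eta> \<longrightarrow> \<eta> < 1 / 2 \<longrightarrow>
       A \<in> orthogonal_group d \<longrightarrow> B \<in> orthogonal_group d \<longrightarrow>
       I \<subseteq> {..<d} \<longrightarrow> card I = m \<longrightarrow>
       real m \<ge> 2025 / \<epsilon>\<^sup>2 * sparsity_level C d s \<eta> \<longrightarrow>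
       144 * kappa I A * (mat_max_norm B)\<^sup>2 * real m * (sparsity_level C d s \<eta>)\<^sup>2 \<le> 1 \<longrightarrow>
       measure_pmf.prob (randomness d)
         {(\<xi>, \<xi>', \<pi>). rip_const s (random_map d I A B \<xi> \<xi>' \<pi>) \<le> \<epsilon>} \<ge> 1 - \<eta>)"
proof (intro exI[of _ 30] conjI allI impI)
  fix d s m :: nat and \<epsilon> \<eta> :: real and A B :: "real mat" and I :: "nat set"
  assume s: "1 \<le> s" "s \<le> d" and \<epsilon>: "0 < \<epsilon>" "\<epsilon> < 1" and \<eta>: "0 < \<eta>" "\<eta> < 1 / 2"
    and A: "A \<in> orthogonal_group d" and B: "B \<in> orthogonal_group d"
    and I: "I \<subseteq> {..<d}" and card_I: "card I = m"
    and m: "2025 / \<epsilon>\<^sup>2 * sparsity_level 30 d s \<eta> \<le> real m"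
    and flat: "144 * kappa I A * (mat_max_norm B)\<^sup>2 * real m * (sparsity_level 30 d s \<eta>)\<^sup>2 \<le> 1"
  let ?A = "sign_vectors d \<times> sign_vectors d \<times> {\<pi>. \<pi> permutes {..<d}}"
  define a where "a = sparsity_level 30 d s \<eta>"
  define L where "L = real s * ln (exp 1 * real d / real s)"
  have d: "1 \<le> real d" using s by simp
  have L: "1 + ln (real d) \<le> L" unfolding L_def by (rule sparsity_ge[OF s])
  \<comment> \<open>The choice C = 30 splits as 27 + 3: 27 L pays for the cardinality of the grid,
    and 3 L for d^2, as 2 ln d <= 3 L. The 16 in the logarithm leaves room for the prefactor
    6.\<close>
  have a_eq: "a = 30 * L + ln (16 / \<eta>)" by (simp add: a_def sparsity_level_def L_def)
  have "0 \<le> ln (real d)" using d by simp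
  moreover have "0 \<le> ln (16 / \<eta>)" using \<eta> by simp
  ultimately have a1: "1 \<le> a" using L a_eq by linarith
  have m': "2025 / \<epsilon>\<^sup>2 * a \<le> m" using m by (simp add: a_def)
  have "1 * (2025 * a) \<le> 1 / \<epsilon>\<^sup>2 * (2025 * a)"
    using \<epsilon> a1 power_le_one[of \<epsilon> 2] by (intro mult_right_mono) auto
  then have m2025: "2025 * a \<le> card I" using m' card_I by simp
  \<comment> \<open>Since 2025 = 45^2, the assumption on m makes sqrt(a/m) at most \<epsilon>/45, so
    the deviation of X is the \<epsilon>/2 that \<open>rip_const_le_of_grid\<close> asks
    for.\<close>
  have q: "45 / 2 * sqrt (a / card I) \<le> \<epsilon> / 2"
  proof -
    have mpos: "0 < real m" using m2025 a1 card_I by linarith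
    have "a / m \<le> (\<epsilon> / 45)\<^sup>2"
      using m' \<epsilon> mpos by (simp add: field_simps power2_eq_square)
    then have "sqrt (a / m) \<le> \<epsilon> / 45" using \<epsilon> by (intro real_le_lsqrt) auto
    then show ?thesis using card_I by simp
  qed
  let ?fail = "\<lambda>n (\<xi>, \<zeta>, \<pi>). \<epsilon> / 2 * (\<Sum>k<d. (grid_point s n k)\<^sup>2)
      < \<bar>isometry_defect (random_map d I A B \<xi> \<zeta> \<pi>) (grid_point s n)\<bar>"
  let ?good = "\<lambda>(\<xi>, \<zeta>, \<pi>). rip_const s (random_map d I A B \<xi> \<zeta> \<pi>) \<le> \<epsilon>"
  have fail: "freq ?A (?fail n) \<le> 6 * (real d)\<^sup>2 * exp (- a)" for n
  proof -
    have "freq ?A (?fail n) \<le> freq ?A (\<lambda>(\<xi>, \<zeta>, \<pi>).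
        45 / 2 * sqrt (a / card I) * (\<Sum>k<d. (grid_point s n k)\<^sup>2)
        < \<bar>isometry_defect (random_map d I A B \<xi> \<zeta> \<pi>) (grid_point s n)\<bar>)"
      using mult_right_mono[OF q, of "\<Sum>k<d. (grid_point s n k)\<^sup>2"]
      by (intro freq_mono) (auto simp: sum_nonneg)
    also have "\<dots> \<le> 6 * (real d)\<^sup>2 * exp (- a)"
      using flat card_I unfolding a_def[symmetric]
      by (intro vector_tail[OF A B I a1 m2025]) simp
    finally show ?thesis .
  qed
  have "1 - freq ?A ?good = freq ?A (\<lambda>\<omega>. \<not> ?good \<omega>)"
  proof -
    have "freq ?A ?good + freq ?A (\<lambda>\<omega>. \<not> ?good \<omega>) = avg ?A (\<lambda>_. 1)"
      unfolding avg_add[symmetric] by (rule avg_cong) auto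
    also have "\<dots> = 1"
      using sign_vectors_finite_nonempty[of d] permutations_finite_nonempty[of d]
      by (intro avg_const) auto
    finally show ?thesis by simp
  qed
  also have "\<dots> \<le> freq ?A (\<lambda>\<omega>. \<exists>n\<in>grid d s. ?fail n \<omega>)"
  proof (rule freq_mono)
    fix \<omega> assume "\<omega> \<in> ?A" and bad: "\<not> ?good \<omega>"
    obtain \<xi> \<zeta> \<pi> where \<omega>: "\<omega> = (\<xi>, \<zeta>, \<pi>)" by (cases \<omega>)
    let ?\<Phi> = "random_map d I A B \<xi> \<zeta> \<pi>"
    have dim: "dim_col ?\<Phi> = d"
      using random_map_carrier[of A d B I] A B I unfolding orthogonal_group_def by blast
    show "\<exists>n\<in>grid d s. ?fail n \<omega>"
    proof (rule ccontr)
      assume "\<not> ?thesis"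
      then have "rip_const s ?\<Phi> \<le> \<epsilon>"
        using s \<epsilon> by (intro rip_const_le_of_grid) (auto simp: dim \<omega> not_less)
      then show False using bad \<omega> by simp
    qed
  qed
  also have "\<dots> \<le> (\<Sum>n\<in>grid d s. freq ?A (?fail n))"
    by (rule freq_Bex_le[OF finite_grid])
  also have "\<dots> \<le> real (card (grid d s)) * (6 * (real d)\<^sup>2 * exp (- a))"
    using sum_mono[of "grid d s" "\<lambda>n. freq ?A (?fail n)", OF fail] by simp
  also have "\<dots> \<le> exp (27 * L) * (6 * (real d)\<^sup>2 * exp (- a))"
    using card_grid_le[OF s] unfolding L_def by (intro mult_right_mono) auto
  also have "(real d)\<^sup>2 = exp (2 * ln (real d))" using d by (simp add: exp_of_nat_mult[of 2, simplified])
  also have "exp (27 * L) * (6 * exp (2 * ln (real d)) * exp (- a))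
      = 6 * exp (2 * ln (real d) - 3 * L) * exp (- ln (16 / \<eta>))"
    by (simp add: a_eq exp_add[symmetric])
  also have "\<dots> \<le> 6 * 1 * exp (- ln (16 / \<eta>))"
    using L \<open>0 \<le> ln (real d)\<close> by (intro mult_right_mono mult_left_mono) auto
  also have "\<dots> = 6 * (\<eta> / 16)" using \<eta> by (simp add: exp_minus)
  also have "\<dots> \<le> \<eta>" using \<eta> by simp
  finally have "1 - \<eta> \<le> freq ?A ?good" by simp
  then show "1 - \<eta> \<le> measure_pmf.prob (randomness d)
      {(\<xi>, \<xi>', \<pi>). rip_const s (random_map d I A B \<xi> \<xi>' \<pi>) \<le> \<epsilon>}"
    using prob_randomness[of d ?good] by simp
qed simp

end
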